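(* Let $n,p\ge1$ and let $\mathcal{M}\in\mathbb{C}^{2n\times2n\times p}$. Assume that for each $i=1,\dots,p$ the Fourier-domain slice $\widehat{\boldsymbol{M}}^{(i)}$ is a real symmetric positive-definite matrix, and that the Fourier-domain slices satisfy the conjugate-symmetry condition $$\widehat{\boldsymbol{M}}^{(1)}=\overline{\widehat{\boldsymbol{M}}^{(1)}},\qquad\widehat{\boldsymbol{M}}^{(p-i+2)}=\overline{\widehat{\boldsymbol{M}}^{(i)}}\quad\text{for every }i=2,\dots,p.$$ Then there exist real-valued tensors $\mathcal{S},\mathcal{D}\in\mathbb{R}^{2n\times2n\times p}$, with $\mathcal{S}$ T-symplectic and $\mathcal{D}$ T-diagonal, such that $\mathcal{M}=\mathcal{S}^H*\mathcal{D}*\mathcal{S}$ and, for each $i=1,\dots,p$, $$\widehat{\boldsymbol{D}}^{(i)}=\begin{bmatrix}\widehat{\boldsymbol{\Lambda}}^{(i)}&\boldsymbol{0}\\\boldsymbol{0}&\widehat{\boldsymbol{\Lambda}}^{(i)}\end{bmatrix},\qquad\widehat{\boldsymbol{\Lambda}}^{(i)}=\operatorname{diag}(\lambda_1^{(i)},\dots,\lambda_n^{(i)}),\quad\lambda_j^{(i)}>0\ (j=1,\dots,n).$$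
   Context: A tensor $\mathcal{A}\in\mathbb{C}^{m\times n\times p}$ has frontal slices $\boldsymbol{A}^{(1)},\dots,\boldsymbol{A}^{(p)}\in\mathbb{C}^{m\times n}$. With $\omega=e^{2\pi\sqrt{-1}/p}$, its Fourier-domain slices are $\widehat{\boldsymbol{A}}^{(i)}=\sum_{j=1}^{p}\omega^{(i-1)(j-1)}\boldsymbol{A}^{(j)}$, $i=1,\dots,p$, with inverse $\boldsymbol{A}^{(j)}=\frac1p\sum_{i=1}^p\omega^{-(i-1)(j-1)}\widehat{\boldsymbol{A}}^{(i)}$. Let $\operatorname{bcirc}(\mathcal{A})\in\mathbb{C}^{mp\times np}$ be the block circulant matrix whose $(r,s)$ block is $\boldsymbol{A}^{(((r-s)\bmod p)+1)}$. The T-product $\mathcal{A}*\mathcal{B}$ is the tensor with $\operatorname{bcirc}(\mathcal{A}*\mathcal{B})=\operatorname{bcirc}(\mathcal{A})\operatorname{bcirc}(\mathcal{B})$; equivalently, if $\mathcal{C}=\mathcal{A}*\mathcal{B}$ then $\widehat{\boldsymbol{C}}^{(i)}=\widehat{\boldsymbol{A}}^{(i)}\widehat{\boldsymbol{B}}^{(i)}$ for all $i$. The T-conjugate transpose $\mathcal{A}^H$ has frontal slices $(\boldsymbol{A}^{(1)})^H$ for $k=1$ and $(\boldsymbol{A}^{(p-k+2)})^H$ for $k\ge2$ (so that $\operatorname{bcirc}(\mathcal{A}^H)=\operatorname{bcirc}(\mathcal{A})^H$). The bar denotes entrywise complex conjugation. Let $\boldsymbol{J}=\begin{bmatrix}\boldsymbol{0}&\boldsymbol{I}_n\\-\boldsymbol{I}_n&\boldsymbol{0}\end{bmatrix}$.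 The T-symplectic unit tensor $\mathcal{J}\in\mathbb{R}^{2n\times2n\times p}$ is the tensor all of whose Fourier-domain slices equal $\boldsymbol{J}$. A tensor $\mathcal{S}\in\mathbb{C}^{2n\times2n\times p}$ is T-symplectic if $\mathcal{S}^H*\mathcal{J}*\mathcal{S}=\mathcal{J}$. A tensor $\mathcal{D}$ with square frontal slices is T-diagonal if each Fourier-domain slice $\widehat{\boldsymbol{D}}^{(i)}$ is a diagonal matrix. *)

theory Defs
  imports Complex_Main "Jordan_Normal_Form.Schur_Decomposition"
begin

text \<open>A tensor is the list of its frontal slices. Slices, in the Fourier domain too, are
  numbered from 1 to p, rows and columns of a slice from 0 as in the matrix library.\<close>

type_synonym 'a tensor = "'a mat list"

definition carrier_tensor :: "nat \<Rightarrow> nat \<Rightarrow> nat \<Rightarrow> 'a tensor set" where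
  "carrier_tensor m n p = {A. length A = p \<and> set A \<subseteq> carrier_mat m n}"

definition frontal_slice :: "'a tensor \<Rightarrow> nat \<Rightarrow> 'a mat" where
  "frontal_slice A k = A ! (k - 1)"

definition tensor_of_slices :: "nat \<Rightarrow> (nat \<Rightarrow> 'a mat) \<Rightarrow> 'a tensor" where
  "tensor_of_slices p F = map F [1..<p + 1]"

definition slice_rows :: "'a tensor \<Rightarrow> nat" where
  "slice_rows A = dim_row (frontal_slice A 1)"

definition slice_cols :: "'a tensor \<Rightarrow> nat" where
  "slice_cols A = dim_col (frontal_slice A 1)"

definition root_unity :: "nat \<Rightarrow> complex" where
  "root_unity p = exp (2 * complex_of_real pi * \<i> / of_nat p)"

definition fourier_slice :: "complex tensor \<Rightarrow> nat \<Rightarrow> complex mat" where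
  "fourier_slice A i = mat (slice_rows A) (slice_cols A)
     (\<lambda>rc. \<Sum>j = 1..length A. root_unity (length A) ^ ((i - 1) * (j - 1)) * frontal_slice A j $$ rc)"

definition tensor_of_fourier ::
    "nat \<Rightarrow> nat \<Rightarrow> nat \<Rightarrow> (nat \<Rightarrow> complex mat) \<Rightarrow> complex tensor" where
  "tensor_of_fourier m n p F = tensor_of_slices p (\<lambda>j. mat m n
     (\<lambda>rc. 1 / of_nat p * (\<Sum>i = 1..p. inverse (root_unity p) ^ ((i - 1) * (j - 1)) * F i $$ rc)))"

definition bcirc :: "'a tensor \<Rightarrow> 'a mat" where
  "bcirc A = (let m = slice_rows A; n = slice_cols A; p = length A in
     mat (m * p) (n * p) (\<lambda>(r, c).
       frontal_slice A (nat ((int (r div m) - int (c div n)) mod int p) + 1) $$ (r mod m, c mod n)))"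

text \<open>Well-definedness of the product is \<open>tprod_unique\<close> and \<open>tprod_bcirc\<close> below.\<close>

definition tprod :: "complex tensor \<Rightarrow> complex tensor \<Rightarrow> complex tensor" (infixl "*\<^sub>T" 70) where
  "A *\<^sub>T B = (THE C. C \<in> carrier_tensor (slice_rows A) (slice_cols B) (length A)
                  \<and> bcirc C = bcirc A * bcirc B)"

definition tconj_transpose :: "complex tensor \<Rightarrow> complex tensor" where
  "tconj_transpose A = tensor_of_slices (length A)
     (\<lambda>k. mat_adjoint (frontal_slice A (if k = 1 then 1 else length A - k + 2)))"

definition J_mat :: "nat \<Rightarrow> complex mat" where
  "J_mat n = four_block_mat (0\<^sub>m n n) (1\<^sub>m n) (- 1\<^sub>m n) (0\<^sub>m n n)"

definition J_tensor :: "nat \<Rightarrow> nat \<Rightarrow> complex tensor" where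
  "J_tensor n p = tensor_of_fourier (2 * n) (2 * n) p (\<lambda>_. J_mat n)"

definition t_symplectic :: "nat \<Rightarrow> nat \<Rightarrow> complex tensor \<Rightarrow> bool" where
  "t_symplectic n p S \<longleftrightarrow> S \<in> carrier_tensor (2 * n) (2 * n) p
     \<and> tconj_transpose S *\<^sub>T J_tensor n p *\<^sub>T S = J_tensor n p"

definition t_diagonal :: "complex tensor \<Rightarrow> bool" where
  "t_diagonal D \<longleftrightarrow> (\<forall>A \<in> set D. square_mat A)
     \<and> (\<forall>i \<in> {1..length D}. diagonal_mat (fourier_slice D i))"

definition real_tensor :: "complex tensor \<Rightarrow> bool" where
  "real_tensor A \<longleftrightarrow> (\<forall>B \<in> set A. elements_mat B \<subseteq> \<real>)"

definition sym_pos_def :: "real mat \<Rightarrow> bool" where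
  "sym_pos_def R \<longleftrightarrow> square_mat R \<and> transpose_mat R = R
     \<and> (\<forall>x \<in> carrier_vec (dim_row R). x \<noteq> 0\<^sub>v (dim_row R) \<longrightarrow> x \<bullet> (R *\<^sub>v x) > 0)"

definition real_sym_pos_def :: "complex mat \<Rightarrow> bool" where
  "real_sym_pos_def A \<longleftrightarrow> (\<exists>R. sym_pos_def R \<and> A = map_mat complex_of_real R)"

lemma frontal_slice_carrier:
  assumes "A \<in> carrier_tensor m n p" "k \<in> {1..p}"
  shows "frontal_slice A k \<in> carrier_mat m n"
proof -
  have "A ! (k - 1) \<in> set A" using assms by (intro nth_mem) (auto simp: carrier_tensor_def)
  then show ?thesis using assms by (auto simp: carrier_tensor_def frontal_slice_def)
qed

lemma carrier_tensorD:
  assumes "A \<in> carrier_tensor m n p" "p \<ge> 1"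
  shows "slice_rows A = m" "slice_cols A = n" "length A = p"
  using frontal_slice_carrier[OF assms(1), of 1] assms
  by (auto simp: carrier_tensor_def slice_rows_def slice_cols_def)

lemma frontal_slice_tensor_of_slices:
  "k \<in> {1..p} \<Longrightarrow> frontal_slice (tensor_of_slices p F) k = F k"
  by (auto simp: frontal_slice_def tensor_of_slices_def nth_map simp del: upt_Suc)

lemma tensor_of_slices_carrier:
  "(\<And>k. k \<in> {1..p} \<Longrightarrow> F k \<in> carrier_mat m n) \<Longrightarrow> tensor_of_slices p F \<in> carrier_tensor m n p"
  by (auto simp: carrier_tensor_def tensor_of_slices_def simp del: upt_Suc)

lemma tensor_eqI:
  assumes "A \<in> carrier_tensor m n p" "B \<in> carrier_tensor m n p"
    and "\<And>k. k \<in> {1..p} \<Longrightarrow> frontal_slice A k = frontal_slice B k"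
  shows "A = B"
proof (rule nth_equalityI)
  show "length A = length B" using assms by (auto simp: carrier_tensor_def)
  fix i assume "i < length A"
  then show "A ! i = B ! i" using assms(1) assms(3)[of "i + 1"]
    by (auto simp: carrier_tensor_def frontal_slice_def)
qed

lemma block_bound:
  fixes r p i m :: nat
  assumes "r < p" "i < m"
  shows "r * m + i < m * p"
proof -
  have "r * m + i < (r + 1) * m" using assms by simp
  also have "\<dots> \<le> p * m" using assms by (intro mult_le_mono1) simp
  finally show ?thesis by (simp add: mult.commute)
qed

lemma bcirc_index:
  assumes "A \<in> carrier_tensor m n p" "r < p" "c < p" "i < m" "j < n"
  shows "bcirc A $$ (r * m + i, c * n + j)
       = frontal_slice A (nat ((int r - int c) mod int p) + 1) $$ (i, j)"
proof -
  have "r * m + i < m * p" using assms by (intro block_bound)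
  moreover have "c * n + j < n * p" using assms by (intro block_bound)
  ultimately show ?thesis using assms by (auto simp: bcirc_def carrier_tensorD Let_def)
qed

lemma bcirc_carrier:
  assumes "A \<in> carrier_tensor m n p" "p \<ge> 1"
  shows "bcirc A \<in> carrier_mat (m * p) (n * p)"
  using assms by (auto simp: bcirc_def carrier_tensorD Let_def)

lemma bcirc_inj:
  assumes A: "A \<in> carrier_tensor m n p" and B: "B \<in> carrier_tensor m n p"
    and "p \<ge> 1" and eq: "bcirc A = bcirc B"
  shows "A = B"
proof (rule tensor_eqI[OF A B])
  fix k assume k: "k \<in> {1..p}"
  show "frontal_slice A k = frontal_slice B k"
  proof (rule eq_matI)
    fix i j assume "i < dim_row (frontal_slice B k)" "j < dim_col (frontal_slice B k)"
    then have ij: "i < m" "j < n" using frontal_slice_carrier[OF B k] by auto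
    have kk: "nat ((int (k - 1) - int 0) mod int p) + 1 = k"
      using k by (auto simp: nat_mod_distrib)
    have "k - 1 < p" "0 < p" using k by auto
    then show "frontal_slice A k $$ (i, j) = frontal_slice B k $$ (i, j)"
      using bcirc_index[OF A _ _ ij, of "k - 1" 0] bcirc_index[OF B _ _ ij, of "k - 1" 0]
      unfolding kk eq by simp
  qed (use frontal_slice_carrier[OF A k] frontal_slice_carrier[OF B k] in auto)
qed

lemma sum_nat_blocks:
  fixes f :: "nat \<Rightarrow> 'a :: comm_monoid_add"
  shows "(\<Sum>k < l * p. f k) = (\<Sum>t < p. \<Sum>k < l. f (t * l + k))"
proof -
  have "(\<Sum>i = t * l..<t * l + l. f i) = (\<Sum>k < l. f (t * l + k))" for t
    using sum.shift_bounds_nat_ivl[of f 0 "t * l" l]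
    by (simp add: add.commute lessThan_atLeast0)
  then show ?thesis using sum.nat_group[of f l p] by (simp add: mult.commute)
qed

lemma bcirc_mult_index:
  assumes A: "A \<in> carrier_tensor m l p" and B: "B \<in> carrier_tensor l n p"
    and "r < p" "c < p" and ij: "i < m" "j < n"
  shows "(bcirc A * bcirc B) $$ (r * m + i, c * n + j)
       = (\<Sum>t < p. \<Sum>k < l. frontal_slice A (nat ((int r - int t) mod int p) + 1) $$ (i, k)
                       * frontal_slice B (nat ((int t - int c) mod int p) + 1) $$ (k, j))"
proof -
  have p: "p \<ge> 1" using assms by auto
  have r: "r * m + i < m * p" using assms by (intro block_bound)
  have c: "c * n + j < n * p" using assms by (intro block_bound)
  have "(bcirc A * bcirc B) $$ (r * m + i, c * n + j)
      = (\<Sum>q < l * p. bcirc A $$ (r * m + i, q) * bcirc B $$ (q, c * n + j))"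
    using bcirc_carrier[OF A p] bcirc_carrier[OF B p] r c
    by (auto simp: scalar_prod_def lessThan_atLeast0 intro!: sum.cong)
  also have "\<dots> = (\<Sum>t < p. \<Sum>k < l. bcirc A $$ (r * m + i, t * l + k) * bcirc B $$ (t * l + k, c * n + j))"
    by (rule sum_nat_blocks)
  also have "\<dots> = (\<Sum>t < p. \<Sum>k < l. frontal_slice A (nat ((int r - int t) mod int p) + 1) $$ (i, k)
                       * frontal_slice B (nat ((int t - int c) mod int p) + 1) $$ (k, j))"
    using assms by (intro sum.cong refl) (simp add: bcirc_index[OF A] bcirc_index[OF B])
  finally show ?thesis .
qed

lemma sum_mod_shift:
  fixes f :: "int \<Rightarrow> 'a :: comm_monoid_add"
  assumes "p \<ge> 1"
  shows "(\<Sum>t < p. f ((int t - int c) mod int p)) = (\<Sum>t < p. f (int t))"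
proof (rule sum.reindex_bij_witness)
  let ?i = "\<lambda>t. nat ((int t + int c) mod int p)" and ?j = "\<lambda>t. nat ((int t - int c) mod int p)"
  fix t assume "t \<in> {..<p}"
  then have t: "int t mod int p = int t" by simp
  have nn: "0 \<le> z mod int p" "z mod int p < int p" for z using assms by auto
  show "?i (?j t) = t" "?j (?i t) = t"
    using nn t by (auto simp: mod_add_left_eq mod_diff_left_eq)
  show "?i t \<in> {..<p}" "?j t \<in> {..<p}" using nn by (auto simp: nat_less_iff)
  show "f (int (?j t)) = f ((int t - int c) mod int p)" using nn by simp
qed

lemma tprod_exists:
  assumes A: "A \<in> carrier_tensor m l p" and B: "B \<in> carrier_tensor l n p" and p: "p \<ge> 1"
  shows "\<exists>C \<in> carrier_tensor m n p. bcirc C = bcirc A * bcirc B"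
proof
  define g where "g u s i j = (\<Sum>k < l. frontal_slice A (nat ((u - s) mod int p) + 1) $$ (i, k)
                       * frontal_slice B (nat (s mod int p) + 1) $$ (k, j))" for u s i j
  define C where "C = tensor_of_slices p
    (\<lambda>u. mat m n (\<lambda>(i, j). \<Sum>t < p. g (int (u - 1)) (int t) i j))"
  show C: "C \<in> carrier_tensor m n p"
    unfolding C_def by (rule tensor_of_slices_carrier) auto
  show "bcirc C = bcirc A * bcirc B"
  proof (rule eq_matI)
    fix x y assume "x < dim_row (bcirc A * bcirc B)" "y < dim_col (bcirc A * bcirc B)"
    then have x: "x < m * p" and y: "y < n * p"
      using bcirc_carrier[OF A p] bcirc_carrier[OF B p] by auto
    define r i c j where rij: "r = x div m" "i = x mod m" "c = y div n" "j = y mod n"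
    have *: "m > 0" "n > 0" using x y by (auto intro: Nat.gr0I)
    then have b: "r < p" "c < p" "i < m" "j < n"
      using x y by (auto simp: rij less_mult_imp_div_less mult.commute)
    have xy: "x = r * m + i" "y = c * n + j" by (auto simp: rij)
    define u where "u = (int r - int c) mod int p"
    have u: "0 \<le> u" "u < int p" using p by (auto simp: u_def)
    have "bcirc C $$ (x, y) = (\<Sum>t < p. g u (int t) i j)"
      using b u unfolding xy bcirc_index[OF C b] u_def[symmetric]
      by (subst C_def, subst frontal_slice_tensor_of_slices) (auto simp: nat_less_iff)
    also have "\<dots> = (\<Sum>t < p. g u ((int t - int c) mod int p) i j)"
      by (rule sum_mod_shift[OF p, symmetric, where f = "\<lambda>t. g u t i j"])
    also have "\<dots> = (bcirc A * bcirc B) $$ (x, y)"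
      unfolding xy bcirc_mult_index[OF A B b] g_def u_def by (simp add: mod_simps)
    finally show "bcirc C $$ (x, y) = (bcirc A * bcirc B) $$ (x, y)" .
  qed (use bcirc_carrier[OF A p] bcirc_carrier[OF B p] bcirc_carrier[OF C p] in auto)
qed

lemma
  assumes A: "A \<in> carrier_tensor m l p" and B: "B \<in> carrier_tensor l n p" and p: "p \<ge> 1"
  shows tprod_carrier: "A *\<^sub>T B \<in> carrier_tensor m n p"
    and tprod_bcirc: "bcirc (A *\<^sub>T B) = bcirc A * bcirc B"
    and tprod_unique: "C \<in> carrier_tensor m n p \<Longrightarrow> bcirc C = bcirc A * bcirc B \<Longrightarrow> C = A *\<^sub>T B"
proof -
  have "\<exists>!C. C \<in> carrier_tensor m n p \<and> bcirc C = bcirc A * bcirc B"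
    using tprod_exists[OF A B p] bcirc_inj[OF _ _ p] by metis
  then have *: "A *\<^sub>T B \<in> carrier_tensor m n p \<and> bcirc (A *\<^sub>T B) = bcirc A * bcirc B"
    using A B p unfolding tprod_def by (simp add: carrier_tensorD) (rule theI')
  then show "A *\<^sub>T B \<in> carrier_tensor m n p" "bcirc (A *\<^sub>T B) = bcirc A * bcirc B" by auto
  show "C = A *\<^sub>T B" if "C \<in> carrier_tensor m n p" "bcirc C = bcirc A * bcirc B"
    using bcirc_inj[OF that(1) conjunct1[OF *] p] conjunct2[OF *] that(2) by (simp only:)
qed

lemma mat_adjoint_index:
  "i < dim_col A \<Longrightarrow> j < dim_row A \<Longrightarrow> mat_adjoint A $$ (i, j) = conjugate (A $$ (j, i))"
  by (simp add: mat_adjoint_def mat_of_rows_index)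

lemma mat_adjoint_carrier: "A \<in> carrier_mat m n \<Longrightarrow> mat_adjoint A \<in> carrier_mat n m"
  by (auto simp: mat_adjoint_def)

lemma tconj_transpose_carrier:
  assumes A: "A \<in> carrier_tensor m n p"
  shows "tconj_transpose A \<in> carrier_tensor n m p"
proof -
  have "length A = p" using A by (simp add: carrier_tensor_def)
  then show ?thesis unfolding tconj_transpose_def
    by (auto intro!: tensor_of_slices_carrier mat_adjoint_carrier frontal_slice_carrier[OF A])
qed

lemma bcirc_tconj_transpose:
  assumes A: "A \<in> carrier_tensor m n p" and p: "p \<ge> 1"
  shows "bcirc (tconj_transpose A) = mat_adjoint (bcirc A)"
proof (rule eq_matI)
  note T = tconj_transpose_carrier[OF A]
  note cT = bcirc_carrier[OF T p] and cA = bcirc_carrier[OF A p]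
  show "dim_row (bcirc (tconj_transpose A)) = dim_row (mat_adjoint (bcirc A))"
    "dim_col (bcirc (tconj_transpose A)) = dim_col (mat_adjoint (bcirc A))"
    using cT mat_adjoint_carrier[OF cA] by auto
  fix x y assume "x < dim_row (mat_adjoint (bcirc A))" "y < dim_col (mat_adjoint (bcirc A))"
  then have x: "x < n * p" and y: "y < m * p" using mat_adjoint_carrier[OF cA] by auto
  define r i c j where rij: "r = x div n" "i = x mod n" "c = y div m" "j = y mod m"
  have *: "m > 0" "n > 0" using x y by (auto intro: Nat.gr0I)
  then have b: "r < p" "c < p" "i < n" "j < m"
    using x y by (auto simp: rij less_mult_imp_div_less mult.commute)
  have xy: "x = r * n + i" "y = c * m + j" by (auto simp: rij)
  define u where "u = nat ((int r - int c) mod int p) + 1"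
  have u: "u \<in> {1..p}"
    using p pos_mod_bound[of "int p" "int r - int c"] by (auto simp: u_def nat_less_iff Suc_le_eq)
  define v where "v = (if u = 1 then 1 else p - u + 2)"
  have v: "v \<in> {1..p}" using u by (auto simp: v_def)
  have "(int c - int r) mod int p = (- ((int r - int c) mod int p)) mod int p"
    by (simp add: mod_minus_eq)
  also have "\<dots> = int v - 1"
  proof -
    have iu: "(int r - int c) mod int p = int u - 1" using p by (simp add: u_def)
    have "(- (int u - 1)) mod int p = int v - 1"
    proof (cases "u = 1")
      case False
      then have "(- (int u - 1)) mod int p = (int p - (int u - 1)) mod int p"
        using minus_mod_self2[of "int p - (int u - 1)" "int p"] by simp
      also have "\<dots> = int p - (int u - 1)" using False u by (intro mod_pos_pos_trivial) auto
      finally show ?thesis using False u by (simp add: v_def)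
    qed (simp add: v_def)
    then show ?thesis unfolding iu .
  qed
  finally have iv: "nat ((int c - int r) mod int p) + 1 = v" using v by auto
  have "bcirc (tconj_transpose A) $$ (x, y) = frontal_slice (tconj_transpose A) u $$ (i, j)"
    unfolding xy bcirc_index[OF T b] u_def ..
  also have "frontal_slice (tconj_transpose A) u = mat_adjoint (frontal_slice A v)"
    using A u carrier_tensorD(3)[OF A p]
    by (simp add: tconj_transpose_def frontal_slice_tensor_of_slices v_def)
  also have "\<dots> $$ (i, j) = conjugate (frontal_slice A v $$ (j, i))"
    using frontal_slice_carrier[OF A v] b by (intro mat_adjoint_index) auto
  also have "\<dots> = conjugate (bcirc A $$ (y, x))"
    unfolding xy bcirc_index[OF A b(2,1,4,3)] iv ..
  also have "\<dots> = mat_adjoint (bcirc A) $$ (x, y)"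
    using cA x y by (intro mat_adjoint_index[symmetric]) auto
  finally show "bcirc (tconj_transpose A) $$ (x, y) = mat_adjoint (bcirc A) $$ (x, y)" .
qed

lemma root_unity_sum:
  assumes p: "p \<ge> 1" and ij: "i \<in> {1..p}" "j \<in> {1..p}"
  shows "(\<Sum>k = 1..p. root_unity p ^ ((i - 1) * (k - 1)) * inverse (root_unity p) ^ ((j - 1) * (k - 1)))
       = (if i = j then of_nat p else 0)"
proof -
  define z where "z = root_unity p ^ (i - 1) * inverse (root_unity p) ^ (j - 1)"
  have nz: "root_unity p \<noteq> 0" by (simp add: root_unity_def)
  have pw: "root_unity p ^ k = exp (2 * complex_of_real pi * \<i> * of_nat k / of_nat p)" for k
    by (simp add: root_unity_def exp_of_nat_mult[symmetric] mult_ac)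
  have rp: "root_unity p ^ p = 1" using p by (simp add: pw mult.commute mult.left_commute)
  have eq: "(\<Sum>k = 1..p. root_unity p ^ ((i - 1) * (k - 1)) * inverse (root_unity p) ^ ((j - 1) * (k - 1)))
      = (\<Sum>k < p. z ^ k)"
    by (rule sum.reindex_bij_witness[of _ "\<lambda>k. k + 1" "\<lambda>k. k - 1"])
       (auto simp: z_def power_mult_distrib power_mult)
  have zp: "z ^ p = 1"
    by (simp add: z_def power_mult_distrib power_mult[symmetric] mult.commute[of _ p])
       (simp add: power_mult power_inverse rp)
  have inj: "a = b" if "a < p" "b < p" "root_unity p ^ a = root_unity p ^ b" for a b
  proof -
    have "exp (2 * complex_of_real pi * \<i> * of_nat a / of_nat p)
        = exp (2 * complex_of_real pi * \<i> * of_nat b / of_nat p)" using that by (simp add: pw)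
    then have "cis (2 * pi * real a / real p) = cis (2 * pi * real b / real p)"
      by (simp add: cis_conv_exp mult_ac)
    moreover have "inj_on (\<lambda>k. cis (2 * pi * real k / real p)) {..<p}"
      using bij_betw_roots_unity[of p] p by (auto simp: bij_betw_def)
    ultimately show ?thesis using that by (auto dest: inj_onD)
  qed
  show ?thesis
  proof (cases "i = j")
    case True
    then have "z = 1" using nz by (simp add: z_def power_mult_distrib[symmetric])
    then show ?thesis using True eq by simp
  next
    case False
    have "z \<noteq> 1"
    proof
      assume "z = 1"
      then have "root_unity p ^ (i - 1) = root_unity p ^ (j - 1)"
        using nz by (simp add: z_def field_simps)
      moreover have "i - 1 < p" "j - 1 < p" using ij by auto
      ultimately have "i - 1 = j - 1" by (rule inj[rotated 2])
      then show False using ij False by auto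
    qed
    then show ?thesis using False eq zp geometric_sum[of z p] by simp
  qed
qed

lemma fourier_slice_tensor_of_fourier:
  assumes p: "p \<ge> 1" and F: "\<And>i. i \<in> {1..p} \<Longrightarrow> F i \<in> carrier_mat m n" and i: "i \<in> {1..p}"
  shows "fourier_slice (tensor_of_fourier m n p F) i = F i"
proof (rule eq_matI)
  let ?T = "tensor_of_fourier m n p F" and ?w = "root_unity p"
  have T: "?T \<in> carrier_tensor m n p"
    unfolding tensor_of_fourier_def by (rule tensor_of_slices_carrier) auto
  note [simp] = carrier_tensorD[OF T p]
  have slice: "frontal_slice ?T j = mat m n (\<lambda>rc. 1 / of_nat p *
      (\<Sum>i = 1..p. inverse ?w ^ ((i - 1) * (j - 1)) * F i $$ rc))" if "j \<in> {1..p}" for j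
    using that unfolding tensor_of_fourier_def by (rule frontal_slice_tensor_of_slices)
  show "dim_row (fourier_slice ?T i) = dim_row (F i)" "dim_col (fourier_slice ?T i) = dim_col (F i)"
    using F[OF i] by (auto simp: fourier_slice_def)
  fix r c assume "r < dim_row (F i)" "c < dim_col (F i)"
  then have rc: "r < m" "c < n" using F[OF i] by auto
  have "fourier_slice ?T i $$ (r, c) = (\<Sum>j = 1..p. ?w ^ ((i - 1) * (j - 1)) *
      (1 / of_nat p * (\<Sum>k = 1..p. inverse ?w ^ ((k - 1) * (j - 1)) * F k $$ (r, c))))"
    using rc by (simp add: fourier_slice_def slice)
  also have "\<dots> = (\<Sum>k = 1..p. \<Sum>j = 1..p. 1 / of_nat p * F k $$ (r, c) *
      (?w ^ ((i - 1) * (j - 1)) * inverse ?w ^ ((k - 1) * (j - 1))))"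
    by (subst sum.swap) (simp add: sum_distrib_left mult_ac)
  also have "\<dots> = (\<Sum>k = 1..p. if i = k then F k $$ (r, c) else 0)"
  proof (intro sum.cong refl)
    fix k assume "k \<in> {1..p}"
    then show "(\<Sum>j = 1..p. 1 / of_nat p * F k $$ (r, c) *
        (?w ^ ((i - 1) * (j - 1)) * inverse ?w ^ ((k - 1) * (j - 1))))
        = (if i = k then F k $$ (r, c) else 0)"
      unfolding sum_distrib_left[symmetric] using p i by (subst root_unity_sum) auto
  qed
  also have "\<dots> = F i $$ (r, c)" using i by simp
  finally show "fourier_slice ?T i $$ (r, c) = F i $$ (r, c)" .
qed

lemma fourier_slice_J_tensor:
  assumes "p \<ge> 1" "i \<in> {1..p}"
  shows "fourier_slice (J_tensor n p) i = J_mat n"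
  unfolding J_tensor_def
  by (rule fourier_slice_tensor_of_fourier[OF assms(1) _ assms(2)]) (auto simp: J_mat_def)

end

theory Submission
  imports Defs "Jordan_Normal_Form.Spectral_Radius"
begin

text \<open>The Fourier transform turns the T-product into the slicewise matrix product, so the slices
  can be factored one by one by Williamson's theorem; the factors form real tensors because the
  slices at \<open>i\<close> and \<open>p - i + 2\<close> are equal and receive the same factors.

  For Williamson's theorem, let \<open>R\<close> be positive definite. An eigenvector \<open>x + \<i> y\<close> of
  \<open>R\<^sup>-\<^sup>1 J\<close> has a purely imaginary eigenvalue, hence \<open>x\<close> and \<open>y\<close> are \<open>R\<close>-orthogonal of
  equal \<open>R\<close>-length and \<open>J x\<close>, \<open>J y\<close> are multiples of \<open>R y\<close>, \<open>R x\<close>. The \<open>R\<close>-orthogonal complement of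
  \<open>x\<close> and \<open>y\<close> is therefore also their \<open>J\<close>-orthogonal complement, and induction on the dimension
  yields a symplectic basis that diagonalizes \<open>R\<close>.\<close>

subsection \<open>Symplectic diagonalization of a positive definite matrix\<close>

text \<open>The columns of \<open>Q\<close> are a basis of the hyperplane orthogonal to
  \<open>a\<close>, so a form \<open>G\<close> restricted to it becomes the smaller matrix
  \<open>transpose_mat Q * G * Q\<close>. The last property is duality: only multiples of
  \<open>a\<close> annihilate the hyperplane. It carries nondegeneracy over to the
  restriction.\<close>

lemma hyperplane_parametrization:
  fixes a :: "'a :: field vec"
  assumes a: "a \<in> carrier_vec (Suc m)" "a \<noteq> 0\<^sub>v (Suc m)"
  obtains Q where "Q \<in> carrier_mat (Suc m) m" "transpose_mat Q *\<^sub>v a = 0\<^sub>v m"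
    "\<And>w. w \<in> carrier_vec m \<Longrightarrow> Q *\<^sub>v w = 0\<^sub>v (Suc m) \<Longrightarrow> w = 0\<^sub>v m"
    "\<And>u. u \<in> carrier_vec (Suc m) \<Longrightarrow> transpose_mat Q *\<^sub>v u = 0\<^sub>v m \<Longrightarrow> \<exists>c. u = c \<cdot>\<^sub>v a"
proof -
  obtain p where p: "p < Suc m" "a $ p \<noteq> 0"
    using a by (metis carrier_vecD eq_vecI index_zero_vec(1,2))
  \<comment> \<open>\<open>s\<close> lists the indices other than the pivot \<open>p\<close>. Column
    \<open>j\<close> of \<open>Q\<close> below is the unit vector at \<open>s j\<close>, corrected
    at the pivot by \<open>- a $ s j / a $ p\<close> so that it becomes orthogonal to
    \<open>a\<close>.\<close>
  define s where "s j = (if j < p then j else Suc j)" for j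
  have s: "s j \<noteq> p" "s j < Suc m" if "j < m" for j using that p by (auto simp: s_def)
  have s_inj: "s j = s k \<longleftrightarrow> j = k" for j k by (auto simp: s_def)
  define Q where "Q = mat (Suc m) m
    (\<lambda>(i, j). if i = s j then 1 else if i = p then - a $ s j / a $ p else 0)"
  have Q: "Q \<in> carrier_mat (Suc m) m" by (simp add: Q_def)
  have QT: "(transpose_mat Q *\<^sub>v u) $ j = u $ s j - a $ s j / a $ p * u $ p"
    if u: "u \<in> carrier_vec (Suc m)" and j: "j < m" for u j
  proof -
    have "(transpose_mat Q *\<^sub>v u) $ j = (\<Sum>i \<in> {0..<Suc m}. Q $$ (i, j) * u $ i)"
      using Q u j by (simp add: scalar_prod_def)
    also have "\<dots> = (\<Sum>i \<in> {0..<Suc m}. (if i = s j then u $ i else 0)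
        + (if i = p then - a $ s j / a $ p * u $ i else 0))"
      using j s by (intro sum.cong) (auto simp: Q_def)
    also have "\<dots> = u $ s j - a $ s j / a $ p * u $ p"
      using s[OF j] p by (simp add: sum.distrib del: sum.op_ivl_Suc)
    finally show ?thesis .
  qed
  show thesis
  proof (rule that[OF Q])
    show "transpose_mat Q *\<^sub>v a = 0\<^sub>v m"
      using Q p by (intro eq_vecI) (auto simp: QT[OF a(1)] simp del: index_mult_mat_vec)
    show "w = 0\<^sub>v m" if w: "w \<in> carrier_vec m" and 0: "Q *\<^sub>v w = 0\<^sub>v (Suc m)" for w
    proof (rule eq_vecI)
      fix j assume "j < dim_vec (0\<^sub>v m :: 'a vec)"
      then have j: "j < m" by simp
      have "(Q *\<^sub>v w) $ s j = (\<Sum>k \<in> {0..<m}. Q $$ (s j, k) * w $ k)"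
        using Q w s[OF j] by (simp add: scalar_prod_def)
      also have "\<dots> = (\<Sum>k \<in> {0..<m}. if k = j then w $ k else 0)"
        using s[OF j] by (intro sum.cong) (auto simp: Q_def s_inj)
      finally show "w $ j = 0\<^sub>v m $ j" using j s[OF j] by (simp add: 0)
    qed (use w in simp)
    show "\<exists>c. u = c \<cdot>\<^sub>v a" if u: "u \<in> carrier_vec (Suc m)" and 0: "transpose_mat Q *\<^sub>v u = 0\<^sub>v m" for u
    proof
      \<comment> \<open>The factor is forced by the entry at the pivot; the vanishing of
        \<open>transpose_mat Q *\<^sub>v u\<close> then determines the other entries.\<close>
      show "u = (u $ p / a $ p) \<cdot>\<^sub>v a"
      proof (rule eq_vecI)
        fix i assume "i < dim_vec ((u $ p / a $ p) \<cdot>\<^sub>v a)"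
        then have i: "i < Suc m" using a by simp
        show "u $ i = ((u $ p / a $ p) \<cdot>\<^sub>v a) $ i"
        proof (cases "i = p")
          case False
          define j where "j = (if i < p then i else i - 1)"
          have j: "j < m" "s j = i" using False i p by (auto simp: j_def s_def)
          show ?thesis using QT[OF u j(1)] 0 j i a by simp
        qed (use i a p in simp)
      qed (use u a in simp)
    qed
  qed
qed

text \<open>An eigenvector \<open>x + i y\<close> with eigenvalue \<open>a + i b\<close> exists over
  the complex numbers; separating real and imaginary parts of the eigenvalue equation leaves real
  data only.\<close>

lemma real_eigenpair:
  fixes A :: "real mat"
  assumes A: "A \<in> carrier_mat m m" and "m > 0"
  obtains a b x y where "x \<in> carrier_vec m" "y \<in> carrier_vec m" "x \<noteq> 0\<^sub>v m \<or> y \<noteq> 0\<^sub>v m"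
    "A *\<^sub>v x = a \<cdot>\<^sub>v x - b \<cdot>\<^sub>v y" "A *\<^sub>v y = a \<cdot>\<^sub>v y + b \<cdot>\<^sub>v x"
proof -
  let ?C = "map_mat complex_of_real A"
  have C: "?C \<in> carrier_mat m m" using A by simp
  obtain c where "eigenvalue ?C c"
    using spectrum_non_empty[OF C \<open>m > 0\<close>] by (auto simp: spectrum_def)
  then obtain z where z: "z \<in> carrier_vec m" "z \<noteq> 0\<^sub>v m" "?C *\<^sub>v z = c \<cdot>\<^sub>v z"
    using A by (auto simp: eigenvalue_def eigenvector_def)
  have Re: "Re ((?C *\<^sub>v z) $ i) = (A *\<^sub>v map_vec Re z) $ i"
    and Im: "Im ((?C *\<^sub>v z) $ i) = (A *\<^sub>v map_vec Im z) $ i" if "i < m" for i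
    using that A z(1) by (auto simp: scalar_prod_def intro!: sum.cong)
  show thesis
  proof (rule that[of "map_vec Re z" "map_vec Im z" "Re c" "Im c"])
    show "map_vec Re z \<noteq> 0\<^sub>v m \<or> map_vec Im z \<noteq> 0\<^sub>v m"
    proof (rule ccontr)
      assume *: "\<not> ?thesis"
      have "z $ i = 0" if "i < m" for i
      proof (rule complex_eqI)
        show "Re (z $ i) = Re 0" "Im (z $ i) = Im 0"
          using * that z(1) by (metis carrier_vecD index_map_vec(1) index_zero_vec(1) zero_complex.sel)+
      qed
      then show False using z by auto
    qed
    show "A *\<^sub>v map_vec Re z = Re c \<cdot>\<^sub>v map_vec Re z - Im c \<cdot>\<^sub>v map_vec Im z"
      using A z(1) by (intro eq_vecI) (auto simp: Re[symmetric] z(3) simp del: index_mult_mat_vec)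
    show "A *\<^sub>v map_vec Im z = Re c \<cdot>\<^sub>v map_vec Im z + Im c \<cdot>\<^sub>v map_vec Re z"
      using A z(1) by (intro eq_vecI) (auto simp: Im[symmetric] z(3) simp del: index_mult_mat_vec)
  qed (use z in auto)
qed

text \<open>A nonzero vector in the kernel of \<open>M\<close> would make the form vanish, so the
  determinant is nonzero.\<close>

lemma pos_def_inverse:
  fixes M :: "real mat"
  assumes M: "M \<in> carrier_mat m m"
    and pos: "\<And>v. v \<in> carrier_vec m \<Longrightarrow> v \<noteq> 0\<^sub>v m \<Longrightarrow> v \<bullet> (M *\<^sub>v v) > 0"
  obtains N where "N \<in> carrier_mat m m" "M * N = 1\<^sub>m m"
proof -
  have "det M \<noteq> 0"
    using pos by (fastforce simp: det_0_iff_vec_prod_zero[OF M])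
  then have "M \<in> Units (ring_mat TYPE(real) m ())" by (rule det_non_zero_imp_unit[OF M])
  then show thesis using that by (auto simp: Units_def ring_mat_def)
qed

section \<open>Simultaneous normal form of a positive definite and a skew form\<close>

text \<open>\<open>M\<close> and \<open>K\<close> stay abstract because the induction applies this
  to restrictions of the original forms. For the inner product \<open>M\<close> the operator
  \<open>M^-1 K\<close> is skew, so its eigenvalues are imaginary, and nonzero since
  \<open>K\<close> is nondegenerate. The value \<open>1 / b\<close> is what makes
  \<open>x \<bullet> (K *\<^sub>v y)\<close> equal to 1.\<close>

lemma pencil_pair:
  fixes M K :: "real mat"
  assumes M: "M \<in> carrier_mat m m" and K: "K \<in> carrier_mat m m" and "m > 0"
    and sym: "\<And>v w. v \<in> carrier_vec m \<Longrightarrow> w \<in> carrier_vec m \<Longrightarrow> v \<bullet> (M *\<^sub>v w) = w \<bullet> (M *\<^sub>v v)"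
    and pos: "\<And>v. v \<in> carrier_vec m \<Longrightarrow> v \<noteq> 0\<^sub>v m \<Longrightarrow> v \<bullet> (M *\<^sub>v v) > 0"
    and skew: "\<And>v w. v \<in> carrier_vec m \<Longrightarrow> w \<in> carrier_vec m \<Longrightarrow> v \<bullet> (K *\<^sub>v w) = - (w \<bullet> (K *\<^sub>v v))"
    and nondeg: "\<And>v. v \<in> carrier_vec m \<Longrightarrow> K *\<^sub>v v = 0\<^sub>v m \<Longrightarrow> v = 0\<^sub>v m"
  obtains x y b where "x \<in> carrier_vec m" "y \<in> carrier_vec m" "b > 0"
    "K *\<^sub>v x = (- b) \<cdot>\<^sub>v (M *\<^sub>v y)" "K *\<^sub>v y = b \<cdot>\<^sub>v (M *\<^sub>v x)"
    "x \<bullet> (M *\<^sub>v x) = 1 / b" "y \<bullet> (M *\<^sub>v y) = 1 / b" "x \<bullet> (M *\<^sub>v y) = 0"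
proof -
  obtain N where N: "N \<in> carrier_mat m m" "M * N = 1\<^sub>m m" using pos_def_inverse[OF M pos] by blast
  have NK: "N * K \<in> carrier_mat m m" using N K by simp
  have MNK: "K *\<^sub>v v = M *\<^sub>v ((N * K) *\<^sub>v v)" if "v \<in> carrier_vec m" for v
  proof -
    have "M *\<^sub>v ((N * K) *\<^sub>v v) = (M * (N * K)) *\<^sub>v v" using M NK that by simp
    also have "M * (N * K) = K" using M N K by (simp add: assoc_mult_mat[symmetric, of _ m m _ m _ m])
    finally show ?thesis by simp
  qed
  obtain a b x y where xy: "x \<in> carrier_vec m" "y \<in> carrier_vec m" "x \<noteq> 0\<^sub>v m \<or> y \<noteq> 0\<^sub>v m"
    and e: "(N * K) *\<^sub>v x = a \<cdot>\<^sub>v x - b \<cdot>\<^sub>v y" "(N * K) *\<^sub>v y = a \<cdot>\<^sub>v y + b \<cdot>\<^sub>v x"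
    by (rule real_eigenpair[OF NK \<open>m > 0\<close>])
  have Mxy: "M *\<^sub>v x \<in> carrier_vec m" "M *\<^sub>v y \<in> carrier_vec m" using M xy by auto
  have Kx: "K *\<^sub>v x = a \<cdot>\<^sub>v (M *\<^sub>v x) - b \<cdot>\<^sub>v (M *\<^sub>v y)"
    using M xy by (simp add: MNK e mult_minus_distrib_mat_vec mult_mat_vec)
  have Ky: "K *\<^sub>v y = a \<cdot>\<^sub>v (M *\<^sub>v y) + b \<cdot>\<^sub>v (M *\<^sub>v x)"
    using M xy by (simp add: MNK e mult_add_distrib_mat_vec mult_mat_vec)
  let ?xx = "x \<bullet> (M *\<^sub>v x)" and ?yy = "y \<bullet> (M *\<^sub>v y)" and ?xy = "x \<bullet> (M *\<^sub>v y)"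
  have yx: "y \<bullet> (M *\<^sub>v x) = ?xy" using sym xy by blast
  note sp = scalar_prod_add_distrib[of _ m] scalar_prod_minus_distrib[of _ m]
  have p: "x \<bullet> (K *\<^sub>v x) = a * ?xx - b * ?xy" "y \<bullet> (K *\<^sub>v y) = a * ?yy + b * ?xy"
    "x \<bullet> (K *\<^sub>v y) = a * ?xy + b * ?xx" "y \<bullet> (K *\<^sub>v x) = a * ?xy - b * ?yy"
    using xy Mxy by (simp_all add: Kx Ky sp yx)
  have nn: "v \<bullet> (M *\<^sub>v v) \<ge> 0" if "v \<in> carrier_vec m" for v
    using pos[OF that] M by (cases "v = 0\<^sub>v m") auto
  have "?xx + ?yy > 0" using pos xy nn by (metis add_nonneg_pos add_pos_nonneg)
  \<comment> \<open>Skewness makes \<open>x \<bullet> (K *\<^sub>v x)\<close> and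
    \<open>y \<bullet> (K *\<^sub>v y)\<close> vanish; in the sum of their expansions the terms with
    \<open>b\<close> cancel.\<close>
  moreover have "a * (?xx + ?yy) = 0" using skew[of x x] skew[of y y] p xy by (simp add: algebra_simps)
  ultimately have a: "a = 0" by simp
  have b: "b \<noteq> 0"
  proof
    assume "b = 0"
    then have "K *\<^sub>v x = 0\<^sub>v m" "K *\<^sub>v y = 0\<^sub>v m" using M xy by (auto simp: Kx Ky a intro!: eq_vecI)
    then show False using nondeg xy by blast
  qed
  \<comment> \<open>With \<open>a = 0\<close>, the vanishing of
    \<open>x \<bullet> (K *\<^sub>v x)\<close> becomes orthogonality, and skewness between
    \<open>x\<close> and \<open>y\<close> compares their lengths.\<close>
  have xy0: "?xy = 0" using p skew[of x x] xy a b by simp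
  have eq: "?xx = ?yy" using p skew[of x y] xy a b by simp
  with \<open>?xx + ?yy > 0\<close> have q: "?xx > 0" by simp
  \<comment> \<open>This scaling brings the common value of the form to
    \<open>1 / \<bar>b\<bar>\<close>; the sign of \<open>b\<close> goes into the second vector so
    that the constant becomes positive.\<close>
  define r where "r = 1 / sqrt (\<bar>b\<bar> * ?xx)"
  have r: "r * r * ?xx = 1 / \<bar>b\<bar>" using q b by (simp add: r_def power2_eq_square[symmetric] power_divide)
  show thesis
  proof (rule that[of "r \<cdot>\<^sub>v x" "(sgn b * r) \<cdot>\<^sub>v y" "\<bar>b\<bar>"])
    have sb: "sgn b * sgn b = 1" using b by (simp add: sgn_if)
    have bs: "\<bar>b\<bar> * sgn b = b" "\<bar>b\<bar> = b * sgn b" by (auto simp: sgn_if)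
    show "K *\<^sub>v (r \<cdot>\<^sub>v x) = (- \<bar>b\<bar>) \<cdot>\<^sub>v (M *\<^sub>v ((sgn b * r) \<cdot>\<^sub>v y))"
      using xy M K by (intro eq_vecI)
        (auto simp: mult_mat_vec[OF M] mult_mat_vec[OF K] Kx a bs(1) mult.assoc[symmetric] simp del: index_mult_mat_vec)
    show "K *\<^sub>v ((sgn b * r) \<cdot>\<^sub>v y) = \<bar>b\<bar> \<cdot>\<^sub>v (M *\<^sub>v (r \<cdot>\<^sub>v x))"
      using xy M K by (intro eq_vecI)
        (auto simp: mult_mat_vec[OF M] mult_mat_vec[OF K] Ky a bs(2) simp del: index_mult_mat_vec)
    show "(r \<cdot>\<^sub>v x) \<bullet> (M *\<^sub>v (r \<cdot>\<^sub>v x)) = 1 / \<bar>b\<bar>"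
      using xy Mxy r by (simp add: mult_mat_vec[OF M] mult.assoc)
    show "((sgn b * r) \<cdot>\<^sub>v y) \<bullet> (M *\<^sub>v ((sgn b * r) \<cdot>\<^sub>v y)) = 1 / \<bar>b\<bar>"
      using xy Mxy r eq sb by (simp add: mult_mat_vec[OF M] mult_ac)
    show "(r \<cdot>\<^sub>v x) \<bullet> (M *\<^sub>v ((sgn b * r) \<cdot>\<^sub>v y)) = 0"
      using xy Mxy xy0 by (simp add: mult_mat_vec[OF M])
  qed (use xy b in auto)
qed


text \<open>For \<open>m = 2 * n\<close> the pairs are a symplectic basis for \<open>K\<close> that
  diagonalizes \<open>M\<close>, with the same value on both members of a pair. Products with a
  \<open>y\<close> on the left and an \<open>x\<close> on the right follow from symmetry and
  skewness.\<close>

definition normal_pairs ::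
    "nat \<Rightarrow> real mat \<Rightarrow> real mat \<Rightarrow> nat \<Rightarrow> (nat \<Rightarrow> real vec) \<Rightarrow> (nat \<Rightarrow> real vec) \<Rightarrow> (nat \<Rightarrow> real) \<Rightarrow> bool"
  where "normal_pairs m M K n x y lam \<longleftrightarrow>
    (\<forall>i < n. x i \<in> carrier_vec m \<and> y i \<in> carrier_vec m \<and> lam i > 0 \<and>
      (\<forall>j < n. x i \<bullet> (M *\<^sub>v x j) = (if i = j then lam i else 0)
             \<and> y i \<bullet> (M *\<^sub>v y j) = (if i = j then lam i else 0)
             \<and> x i \<bullet> (M *\<^sub>v y j) = 0 \<and> x i \<bullet> (K *\<^sub>v x j) = 0 \<and> y i \<bullet> (K *\<^sub>v y j) = 0
             \<and> x i \<bullet> (K *\<^sub>v y j) = (if i = j then 1 else 0)))"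

text \<open>Induction on \<open>n\<close> splits off one pair and passes to its complement.
  \<open>K\<close> has to be an arbitrary nondegenerate skew matrix, since the standard
  \<open>J\<close> need not keep its shape in the coordinates of the complement.\<close>

lemma normal_pairs_exist:
  fixes M K :: "real mat"
  assumes "M \<in> carrier_mat (2 * n) (2 * n)" and "K \<in> carrier_mat (2 * n) (2 * n)"
    and "\<And>v w. v \<in> carrier_vec (2 * n) \<Longrightarrow> w \<in> carrier_vec (2 * n) \<Longrightarrow> v \<bullet> (M *\<^sub>v w) = w \<bullet> (M *\<^sub>v v)"
    and "\<And>v. v \<in> carrier_vec (2 * n) \<Longrightarrow> v \<noteq> 0\<^sub>v (2 * n) \<Longrightarrow> v \<bullet> (M *\<^sub>v v) > 0"
    and "\<And>v w. v \<in> carrier_vec (2 * n) \<Longrightarrow> w \<in> carrier_vec (2 * n) \<Longrightarrow> v \<bullet> (K *\<^sub>v w) = - (w \<bullet> (K *\<^sub>v v))"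
    and "\<And>v. v \<in> carrier_vec (2 * n) \<Longrightarrow> K *\<^sub>v v = 0\<^sub>v (2 * n) \<Longrightarrow> v = 0\<^sub>v (2 * n)"
  shows "\<exists>x y lam. normal_pairs (2 * n) M K n x y lam"
  using assms
proof (induction n arbitrary: M K)
  case 0
  then show ?case by (simp add: normal_pairs_def)
next
  case (Suc n)
  \<comment> \<open>\<open>k\<close> is the dimension of the complement; \<open>m\<close> is written
    with successors to match two applications of \<open>hyperplane_parametrization\<close>.\<close>
  define k m where "k = 2 * n" and "m = Suc (Suc k)"
  have m: "2 * Suc n = m" by (simp add: k_def m_def)
  have "m > 0" by (simp add: m_def)
  note hyps = Suc.prems[unfolded m]
  note M = hyps(1) and K = hyps(2) and sym = hyps(3) and pos = hyps(4) and skew = hyps(5)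
    and nondeg = hyps(6)
  obtain x y b where xy: "x \<in> carrier_vec m" "y \<in> carrier_vec m" and b: "b > 0"
    and Kx: "K *\<^sub>v x = (- b) \<cdot>\<^sub>v (M *\<^sub>v y)" and Ky: "K *\<^sub>v y = b \<cdot>\<^sub>v (M *\<^sub>v x)"
    and q: "x \<bullet> (M *\<^sub>v x) = 1 / b" "y \<bullet> (M *\<^sub>v y) = 1 / b" "x \<bullet> (M *\<^sub>v y) = 0"
    by (rule pencil_pair[OF M K \<open>m > 0\<close> sym pos skew nondeg])
  have yx: "y \<bullet> (M *\<^sub>v x) = 0" using sym xy q by simp
  have Mxy: "M *\<^sub>v x \<in> carrier_vec m" "M *\<^sub>v y \<in> carrier_vec m" using M xy by auto
  have "M *\<^sub>v x \<noteq> 0\<^sub>v m" using q b xy by auto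
  \<comment> \<open>The complement is cut out by \<open>M x\<close> and \<open>M y\<close>:
    \<open>Q1\<close> parametrizes the first hyperplane, and \<open>Q2\<close> the second condition
    pulled back along \<open>Q1\<close>.\<close>
  then obtain Q1 where Q1: "Q1 \<in> carrier_mat m (Suc k)" "transpose_mat Q1 *\<^sub>v (M *\<^sub>v x) = 0\<^sub>v (Suc k)"
    and Q1_inj: "\<And>w. w \<in> carrier_vec (Suc k) \<Longrightarrow> Q1 *\<^sub>v w = 0\<^sub>v m \<Longrightarrow> w = 0\<^sub>v (Suc k)"
    and Q1_ker: "\<And>u. u \<in> carrier_vec m \<Longrightarrow> transpose_mat Q1 *\<^sub>v u = 0\<^sub>v (Suc k) \<Longrightarrow> \<exists>c. u = c \<cdot>\<^sub>v (M *\<^sub>v x)"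
    using hyperplane_parametrization[of "M *\<^sub>v x" "Suc k"] Mxy unfolding m_def by metis
  have Q1T: "transpose_mat Q1 \<in> carrier_mat (Suc k) m" using Q1 by simp
  \<comment> \<open>Otherwise \<open>M y\<close> would be a multiple of \<open>M x\<close>, and
    pairing with \<open>y\<close> would give 0 instead of \<open>1 / b\<close>.\<close>
  have "transpose_mat Q1 *\<^sub>v (M *\<^sub>v y) \<noteq> 0\<^sub>v (Suc k)"
  proof
    assume "transpose_mat Q1 *\<^sub>v (M *\<^sub>v y) = 0\<^sub>v (Suc k)"
    then obtain c where c: "M *\<^sub>v y = c \<cdot>\<^sub>v (M *\<^sub>v x)" using Q1_ker Mxy by blast
    then have "y \<bullet> (M *\<^sub>v y) = 0" using xy Mxy yx by simp
    then show False using q b by simp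
  qed
  moreover have "transpose_mat Q1 *\<^sub>v (M *\<^sub>v y) \<in> carrier_vec (Suc k)" using Q1T Mxy by simp
  ultimately obtain Q2 where Q2: "Q2 \<in> carrier_mat (Suc k) k"
      "transpose_mat Q2 *\<^sub>v (transpose_mat Q1 *\<^sub>v (M *\<^sub>v y)) = 0\<^sub>v k"
    and Q2_inj: "\<And>w. w \<in> carrier_vec k \<Longrightarrow> Q2 *\<^sub>v w = 0\<^sub>v (Suc k) \<Longrightarrow> w = 0\<^sub>v k"
    and Q2_ker: "\<And>u. u \<in> carrier_vec (Suc k) \<Longrightarrow> transpose_mat Q2 *\<^sub>v u = 0\<^sub>v k
      \<Longrightarrow> \<exists>c. u = c \<cdot>\<^sub>v (transpose_mat Q1 *\<^sub>v (M *\<^sub>v y))"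
    using hyperplane_parametrization[of "transpose_mat Q1 *\<^sub>v (M *\<^sub>v y)" k] by metis
  have Q2T: "transpose_mat Q2 \<in> carrier_mat k (Suc k)" using Q2 by simp
  define Q where "Q = Q1 * Q2"
  have Q: "Q \<in> carrier_mat m k" using Q1 Q2 by (simp add: Q_def)
  then have QT: "transpose_mat Q \<in> carrier_mat k m" by simp
  have QTv: "transpose_mat Q *\<^sub>v v = transpose_mat Q2 *\<^sub>v (transpose_mat Q1 *\<^sub>v v)"
    if "v \<in> carrier_vec m" for v
    using that Q1 Q2 Q1T Q2T by (simp add: Q_def transpose_mult)
  have Q_inj: "w = 0\<^sub>v k" if "w \<in> carrier_vec k" "Q *\<^sub>v w = 0\<^sub>v m" for w
  proof -
    have "Q1 *\<^sub>v (Q2 *\<^sub>v w) = 0\<^sub>v m" using that Q1 Q2 by (simp add: Q_def)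
    then show ?thesis using Q1_inj Q2_inj that Q2(1) by (metis mult_mat_vec_carrier)
  qed
  have adj: "(Q *\<^sub>v w) \<bullet> u = w \<bullet> (transpose_mat Q *\<^sub>v u)" if "w \<in> carrier_vec k" "u \<in> carrier_vec m" for w u
    using transpose_vec_mult_scalar[OF Q that] that Q QT
    by (metis comm_scalar_prod mult_mat_vec_carrier)
  have Qc: "Q *\<^sub>v w \<in> carrier_vec m" if "w \<in> carrier_vec k" for w using Q that by simp
  have QTx: "transpose_mat Q *\<^sub>v (M *\<^sub>v x) = 0\<^sub>v k"
    using Q1(2) Q2T Mxy by (simp add: QTv) (auto intro!: eq_vecI)
  have QTy: "transpose_mat Q *\<^sub>v (M *\<^sub>v y) = 0\<^sub>v k"
    using Q2 Mxy by (simp add: QTv)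
  \<comment> \<open>\<open>K x\<close> and \<open>K y\<close> are multiples of \<open>M y\<close>
    and \<open>M x\<close>, so \<open>M\<close>-orthogonality to the pair is also
    \<open>K\<close>-orthogonality.\<close>
  have orth: "(Q *\<^sub>v w) \<bullet> (M *\<^sub>v x) = 0" "(Q *\<^sub>v w) \<bullet> (M *\<^sub>v y) = 0"
    "x \<bullet> (M *\<^sub>v (Q *\<^sub>v w)) = 0" "y \<bullet> (M *\<^sub>v (Q *\<^sub>v w)) = 0"
    "(Q *\<^sub>v w) \<bullet> (K *\<^sub>v x) = 0" "(Q *\<^sub>v w) \<bullet> (K *\<^sub>v y) = 0"
    "x \<bullet> (K *\<^sub>v (Q *\<^sub>v w)) = 0" "y \<bullet> (K *\<^sub>v (Q *\<^sub>v w)) = 0" if w: "w \<in> carrier_vec k" for w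
  proof -
    show 1: "(Q *\<^sub>v w) \<bullet> (M *\<^sub>v x) = 0" "(Q *\<^sub>v w) \<bullet> (M *\<^sub>v y) = 0"
      using w Mxy by (simp_all add: adj QTx QTy)
    then show "x \<bullet> (M *\<^sub>v (Q *\<^sub>v w)) = 0" "y \<bullet> (M *\<^sub>v (Q *\<^sub>v w)) = 0"
      using sym[OF xy(1) Qc[OF w]] sym[OF xy(2) Qc[OF w]] by simp_all
    show 2: "(Q *\<^sub>v w) \<bullet> (K *\<^sub>v x) = 0" "(Q *\<^sub>v w) \<bullet> (K *\<^sub>v y) = 0"
      unfolding Kx Ky using 1 Mxy Qc[OF w] by simp_all
    then show "x \<bullet> (K *\<^sub>v (Q *\<^sub>v w)) = 0" "y \<bullet> (K *\<^sub>v (Q *\<^sub>v w)) = 0"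
      using skew[OF xy(1) Qc[OF w]] skew[OF xy(2) Qc[OF w]] by simp_all
  qed
  \<comment> \<open>The two forms restricted to the complement, in the coordinates given by
    \<open>Q\<close>.\<close>
  define M' K' where "M' = transpose_mat Q * (M * Q)" and "K' = transpose_mat Q * (K * Q)"
  have M': "M' \<in> carrier_mat k k" and K': "K' \<in> carrier_mat k k"
    using M K Q by (auto simp: M'_def K'_def)
  have M'v: "M' *\<^sub>v w = transpose_mat Q *\<^sub>v (M *\<^sub>v (Q *\<^sub>v w))"
    and K'v: "K' *\<^sub>v w = transpose_mat Q *\<^sub>v (K *\<^sub>v (Q *\<^sub>v w))" if "w \<in> carrier_vec k" for w
    using that M K Q QT by (simp_all add: M'_def K'_def assoc_mult_mat_vec[of _ _ m _ k])
  have MQ: "M *\<^sub>v (Q *\<^sub>v w) \<in> carrier_vec m" "K *\<^sub>v (Q *\<^sub>v w) \<in> carrier_vec m" if "w \<in> carrier_vec k" for w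
    using that M K Qc by auto
  have form: "v \<bullet> (M' *\<^sub>v w) = (Q *\<^sub>v v) \<bullet> (M *\<^sub>v (Q *\<^sub>v w))"
    "v \<bullet> (K' *\<^sub>v w) = (Q *\<^sub>v v) \<bullet> (K *\<^sub>v (Q *\<^sub>v w))"
    if "v \<in> carrier_vec k" "w \<in> carrier_vec k" for v w
    using that MQ by (simp_all add: M'v K'v adj)
  \<comment> \<open>By the two kernel statements, a vector \<open>?u\<close> annihilated by
    \<open>transpose_mat Q\<close> is a combination of \<open>M x\<close> and \<open>M y\<close>.
    Pairing it with \<open>x\<close> and \<open>y\<close> isolates the coefficients, and these
    pairings vanish by \<open>orth\<close>.\<close>
  have nondeg': "w = 0\<^sub>v k" if w: "w \<in> carrier_vec k" and 0: "K' *\<^sub>v w = 0\<^sub>v k" for w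
  proof -
    let ?u = "K *\<^sub>v (Q *\<^sub>v w)"
    have u: "?u \<in> carrier_vec m" using MQ w by blast
    then have "transpose_mat Q2 *\<^sub>v (transpose_mat Q1 *\<^sub>v ?u) = 0\<^sub>v k"
      using 0 w QTv by (simp add: K'v)
    moreover have "transpose_mat Q1 *\<^sub>v ?u \<in> carrier_vec (Suc k)" using Q1T u by simp
    ultimately obtain c where c: "transpose_mat Q1 *\<^sub>v ?u = c \<cdot>\<^sub>v (transpose_mat Q1 *\<^sub>v (M *\<^sub>v y))"
      using Q2_ker by blast
    have "transpose_mat Q1 *\<^sub>v (?u - c \<cdot>\<^sub>v (M *\<^sub>v y)) = 0\<^sub>v (Suc k)"
      using u Mxy Q1T c by (simp add: mult_minus_distrib_mat_vec[of _ _ m] mult_mat_vec[of _ _ m])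
    then obtain d where d: "?u - c \<cdot>\<^sub>v (M *\<^sub>v y) = d \<cdot>\<^sub>v (M *\<^sub>v x)"
      using Q1_ker u Mxy by (meson minus_carrier_vec smult_carrier_vec)
    have "?u = (?u - c \<cdot>\<^sub>v (M *\<^sub>v y)) + c \<cdot>\<^sub>v (M *\<^sub>v y)" using u M K Mxy by (auto intro!: eq_vecI)
    then have ue: "?u = d \<cdot>\<^sub>v (M *\<^sub>v x) + c \<cdot>\<^sub>v (M *\<^sub>v y)" unfolding d .
    have "x \<bullet> ?u = d / b" "y \<bullet> ?u = c / b"
      unfolding ue using xy Mxy by (simp_all add: scalar_prod_add_distrib[of _ m] q yx)
    then have "d = 0" "c = 0" using orth(7,8)[OF w] b by auto
    then have "?u = 0\<^sub>v m" unfolding ue using M K Mxy by (auto intro!: eq_vecI)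
    then show ?thesis using nondeg Qc[OF w] Q_inj[OF w] by blast
  qed
  have sym': "v \<bullet> (M' *\<^sub>v w) = w \<bullet> (M' *\<^sub>v v)"
    and skew': "v \<bullet> (K' *\<^sub>v w) = - (w \<bullet> (K' *\<^sub>v v))"
    if "v \<in> carrier_vec k" "w \<in> carrier_vec k" for v w
    unfolding form[OF that] form[OF that(2,1)] using that Qc by (intro sym skew; blast)+
  have pos': "v \<bullet> (M' *\<^sub>v v) > 0" if "v \<in> carrier_vec k" "v \<noteq> 0\<^sub>v k" for v
    using that pos Qc Q_inj by (auto simp: form)
  obtain x' y' l where "normal_pairs k M' K' n x' y' l"
    using Suc.IH[folded k_def, OF M' K' sym' pos' skew' nondeg'] by blast
  note IH = this[unfolded normal_pairs_def, rule_format]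
  have c': "x' i \<in> carrier_vec k" "y' i \<in> carrier_vec k" if "i < n" for i using IH[OF that] by auto
  \<comment> \<open>The lifted pairs keep the indices below \<open>n\<close>; the split-off pair
    takes index \<open>n\<close> with the value \<open>1 / b\<close>.\<close>
  let ?x = "\<lambda>i. if i < n then Q *\<^sub>v x' i else x" and ?y = "\<lambda>i. if i < n then Q *\<^sub>v y' i else y"
    and ?l = "\<lambda>i. if i < n then l i else 1 / b"
  have K0: "x \<bullet> (K *\<^sub>v x) = 0" "y \<bullet> (K *\<^sub>v y) = 0" "x \<bullet> (K *\<^sub>v y) = 1"
    using xy Mxy q yx b by (simp_all add: Kx Ky)
  have "normal_pairs m M K (Suc n) ?x ?y ?l"
    unfolding normal_pairs_def
  proof (intro allI impI)
    fix i assume i: "i < Suc n"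
    have "?x i \<bullet> (M *\<^sub>v ?x j) = (if i = j then ?l i else 0)
        \<and> ?y i \<bullet> (M *\<^sub>v ?y j) = (if i = j then ?l i else 0)
        \<and> ?x i \<bullet> (M *\<^sub>v ?y j) = 0 \<and> ?x i \<bullet> (K *\<^sub>v ?x j) = 0 \<and> ?y i \<bullet> (K *\<^sub>v ?y j) = 0
        \<and> ?x i \<bullet> (K *\<^sub>v ?y j) = (if i = j then 1 else 0)" if j: "j < Suc n" for j
    proof (cases "i < n"; cases "j < n")
      assume ij: "i < n" "j < n"
      then show ?thesis using IH[of i] c' by (auto simp: form[symmetric])
    next
      assume ij: "i < n" "\<not> j < n"
      then show ?thesis using c' by (auto simp: orth)
    next
      assume ij: "\<not> i < n" "j < n"
      then show ?thesis using c' by (auto simp: orth)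
    next
      assume ij: "\<not> i < n" "\<not> j < n"
      then show ?thesis using i j by (auto simp: q K0)
    qed
    then show "?x i \<in> carrier_vec m \<and> ?y i \<in> carrier_vec m \<and> ?l i > 0 \<and>
      (\<forall>j < Suc n. ?x i \<bullet> (M *\<^sub>v ?x j) = (if i = j then ?l i else 0)
        \<and> ?y i \<bullet> (M *\<^sub>v ?y j) = (if i = j then ?l i else 0)
        \<and> ?x i \<bullet> (M *\<^sub>v ?y j) = 0 \<and> ?x i \<bullet> (K *\<^sub>v ?x j) = 0 \<and> ?y i \<bullet> (K *\<^sub>v ?y j) = 0
        \<and> ?x i \<bullet> (K *\<^sub>v ?y j) = (if i = j then 1 else 0))"
      using IH[of i] Qc xy b by auto
  qed
  then show ?case unfolding m by blast
qed

section \<open>Williamson's theorem for real matrices\<close>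

text \<open>Entrywise, a congruence evaluates the form \<open>G\<close> on the columns of
  \<open>T\<close>; this translates \<open>normal_pairs\<close> into matrix identities.\<close>

lemma congruence_index:
  fixes G T :: "'a :: comm_ring_1 mat"
  assumes "G \<in> carrier_mat m m" "T \<in> carrier_mat m k" "i < k" "j < k"
  shows "(transpose_mat T * G * T) $$ (i, j) = col T i \<bullet> (G *\<^sub>v col T j)"
proof -
  have "transpose_mat T * G * T = transpose_mat T * (G * T)"
    using assms by (intro assoc_mult_mat[of _ k m _ m _ k]) auto
  moreover have "col (G * T) j = G *\<^sub>v col T j" using assms by (intro eq_vecI) auto
  ultimately show ?thesis using assms by simp
qed

text \<open>The inverse undoes a congruence, so a normal form reached through \<open>T\<close>
  becomes a factorization through \<open>S\<close>.\<close>

lemma congruence_inverse: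
  fixes G T S :: "'a :: comm_ring_1 mat"
  assumes G: "G \<in> carrier_mat m m" and T: "T \<in> carrier_mat m m" and S: "S \<in> carrier_mat m m"
    and TS: "T * S = 1\<^sub>m m"
  shows "transpose_mat S * (transpose_mat T * G * T) * S = G"
proof -
  have S': "transpose_mat S \<in> carrier_mat m m" and T': "transpose_mat T \<in> carrier_mat m m"
    using S T by auto
  have "transpose_mat S * transpose_mat T = 1\<^sub>m m"
    using transpose_mult[OF T S] TS by simp
  then have "transpose_mat S * (transpose_mat T * (G * (T * S))) = G"
    unfolding TS using S' T' G by (simp add: assoc_mult_mat[symmetric, of _ m m _ m _ m])
  moreover have "transpose_mat S * (transpose_mat T * G * T) * S
      = transpose_mat S * (transpose_mat T * (G * (T * S)))"
    using S' T' G S T by (simp add: assoc_mult_mat[of _ m m _ m _ m])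
  ultimately show ?thesis by simp
qed

text \<open>A real copy of \<open>J_mat\<close>, since the symplectic basis is built over the reals;
  \<open>map_real_J\<close> relates the two.\<close>

definition real_J :: "nat \<Rightarrow> real mat" where
  "real_J n = four_block_mat (0\<^sub>m n n) (1\<^sub>m n) (- 1\<^sub>m n) (0\<^sub>m n n)"

lemma real_J_carrier: "real_J n \<in> carrier_mat (2 * n) (2 * n)"
  by (auto simp: real_J_def)

lemma real_J_index:
  assumes "i < 2 * n" "j < 2 * n"
  shows "real_J n $$ (i, j) = (if j = i + n then 1 else if i = j + n then -1 else 0)"
  using assms by (auto simp: real_J_def)

lemma real_J_square: "real_J n * real_J n = - 1\<^sub>m (2 * n)"
proof -
  have "real_J n * real_J n = four_block_mat (- 1\<^sub>m n) (0\<^sub>m n n) (0\<^sub>m n n) (- 1\<^sub>m n)"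
    unfolding real_J_def by (subst mult_four_block_mat[of _ n n _ n _ n _ _ n _ n]) auto
  also have "\<dots> = - 1\<^sub>m (2 * n)" by (rule eq_matI) auto
  finally show ?thesis .
qed

lemma transpose_real_J: "transpose_mat (real_J n) = - real_J n"
proof (rule eq_matI)
  fix i j assume "i < dim_row (- real_J n)" "j < dim_col (- real_J n)"
  then have "i < 2 * n" "j < 2 * n" using real_J_carrier[of n] by auto
  then show "transpose_mat (real_J n) $$ (i, j) = (- real_J n) $$ (i, j)"
    using real_J_carrier[of n] by (auto simp: real_J_index)
qed (use real_J_carrier[of n] in auto)

text \<open>The normal pairs, taken as columns, form a symplectic matrix \<open>T\<close> that
  diagonalizes \<open>R\<close> by congruence. The required \<open>S\<close> is the inverse of
  \<open>T\<close>.\<close>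

lemma real_williamson:
  fixes R :: "real mat"
  assumes R: "R \<in> carrier_mat (2 * n) (2 * n)" and spd: "sym_pos_def R"
  shows "\<exists>S lam. S \<in> carrier_mat (2 * n) (2 * n) \<and> (\<forall>j < n. lam j > 0)
    \<and> transpose_mat S * real_J n * S = real_J n
    \<and> R = transpose_mat S * four_block_mat (mat_diag n lam) (0\<^sub>m n n) (0\<^sub>m n n) (mat_diag n lam) * S"
proof -
  let ?m = "2 * n" and ?J = "real_J n"
  note J = real_J_carrier[of n]
  have mv: "(G *\<^sub>v v) \<bullet> w = w \<bullet> (G *\<^sub>v v)"
    if "G \<in> carrier_mat ?m ?m" "v \<in> carrier_vec ?m" "w \<in> carrier_vec ?m" for G :: "real mat" and v w
    using that by (intro comm_scalar_prod[of _ ?m]) auto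
  have sym: "v \<bullet> (R *\<^sub>v w) = w \<bullet> (R *\<^sub>v v)" if "v \<in> carrier_vec ?m" "w \<in> carrier_vec ?m" for v w
    using transpose_vec_mult_scalar[OF R that(2,1)] spd that mv[OF R that] by (simp add: sym_pos_def_def)
  have skew: "v \<bullet> (?J *\<^sub>v w) = - (w \<bullet> (?J *\<^sub>v v))" if "v \<in> carrier_vec ?m" "w \<in> carrier_vec ?m" for v w
    using transpose_vec_mult_scalar[OF J that(2,1)] that mv[OF J that] J by (simp add: transpose_real_J)
  have nondeg: "v = 0\<^sub>v ?m" if v: "v \<in> carrier_vec ?m" and 0: "?J *\<^sub>v v = 0\<^sub>v ?m" for v
  proof -
    have "?J *\<^sub>v (?J *\<^sub>v v) = - v"
      using assoc_mult_mat_vec[OF J J v] v by (simp add: real_J_square)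
    moreover have "?J *\<^sub>v 0\<^sub>v ?m = 0\<^sub>v ?m" using J by (intro eq_vecI) auto
    ultimately have "- v = 0\<^sub>v ?m" using 0 by simp
    then have "- (- v) = 0\<^sub>v ?m" by simp
    then show ?thesis by simp
  qed
  have pos: "v \<bullet> (R *\<^sub>v v) > 0" if "v \<in> carrier_vec ?m" "v \<noteq> 0\<^sub>v ?m" for v
    using spd R that by (auto simp: sym_pos_def_def)
  obtain x y lam where "normal_pairs ?m R ?J n x y lam"
    using normal_pairs_exist[OF R J sym pos skew nondeg] by blast
  note xy = this[unfolded normal_pairs_def, rule_format]
  have c: "x i \<in> carrier_vec ?m" "y i \<in> carrier_vec ?m" if "i < n" for i using xy[OF that] by auto
  \<comment> \<open>All \<open>x\<close> columns precede all \<open>y\<close> columns, the order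
    that yields the block shapes of \<open>real_J\<close> and of the doubled diagonal.\<close>
  define t where "t j = (if j < n then x j else y (j - n))" for j
  have t: "t j \<in> carrier_vec ?m" if "j < ?m" for j
    using c that by (auto simp: t_def)
  define T where "T = mat ?m ?m (\<lambda>(i, j). t j $ i)"
  have T: "T \<in> carrier_mat ?m ?m" by (simp add: T_def)
  have colT: "col T j = t j" if "j < ?m" for j
    using t[OF that] that by (intro eq_vecI) (auto simp: T_def)
  let ?D = "four_block_mat (mat_diag n lam) (0\<^sub>m n n) (0\<^sub>m n n) (mat_diag n lam)"
  have yx: "y i \<bullet> (R *\<^sub>v x j) = 0" "y i \<bullet> (?J *\<^sub>v x j) = (if i = j then -1 else 0)" if "i < n" "j < n" for i j
    using xy[OF that(2)] that c sym[of "y i" "x j"] skew[of "y i" "x j"] by auto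
  have TRT: "transpose_mat T * R * T = ?D"
  proof (rule eq_matI)
    fix i j assume "i < dim_row ?D" "j < dim_col ?D"
    then have ij: "i < ?m" "j < ?m" by (auto simp: mat_diag_def)
    \<comment> \<open>Column \<open>i\<close> of \<open>T\<close> is \<open>y (i - n)\<close> when
      \<open>n \<le> i\<close>, hence the second instance of \<open>xy\<close>.\<close>
    then show "(transpose_mat T * R * T) $$ (i, j) = ?D $$ (i, j)"
      using xy[of i] xy[of "i - n"] yx(1)
      by (simp only: congruence_index[OF R T ij] colT) (auto simp: t_def mat_diag_def)
  qed (use T in \<open>auto simp: mat_diag_def\<close>)
  have TJT: "transpose_mat T * ?J * T = ?J"
  proof (rule eq_matI)
    fix i j assume "i < dim_row ?J" "j < dim_col ?J"
    then have ij: "i < ?m" "j < ?m" using J by auto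
    then show "(transpose_mat T * ?J * T) $$ (i, j) = ?J $$ (i, j)"
      using xy[of i] xy[of "i - n"] yx(2)
      by (simp only: congruence_index[OF J T ij] colT) (auto simp: t_def real_J_index)
  qed (use T J in auto)
  \<comment> \<open>From \<open>T^T J T = J\<close> and \<open>J^-1 = - J\<close> the inverse of
    \<open>T\<close> is \<open>- J T^T J\<close>.\<close>
  define S where "S = - ?J * (transpose_mat T * ?J)"
  have T': "transpose_mat T \<in> carrier_mat ?m ?m" using T by simp
  have S: "S \<in> carrier_mat ?m ?m" using J T by (auto simp: S_def)
  have "S * T = - ?J * (transpose_mat T * ?J * T)"
    unfolding S_def using J T T' by (intro assoc_mult_mat[of _ ?m ?m _ ?m _ ?m]) auto
  also have "\<dots> = - (?J * ?J)" unfolding TJT using J by simp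
  also have "\<dots> = 1\<^sub>m ?m" unfolding real_J_square by (intro eq_matI) auto
  finally have TS: "T * S = 1\<^sub>m ?m" by (rule mat_mult_left_right_inverse[OF S T])
  have "transpose_mat S * ?J * S = ?J" "R = transpose_mat S * ?D * S"
    using congruence_inverse[OF J T S TS] congruence_inverse[OF R T S TS] by (simp_all add: TRT TJT)
  then show ?thesis using S xy by blast
qed

section \<open>Passage to complex matrices with real entries\<close>

lemma real_of_mat_mult:
  assumes "A \<in> carrier_mat l m" "B \<in> carrier_mat m n"
  shows "map_mat complex_of_real (A * B) = map_mat complex_of_real A * map_mat complex_of_real B"
  using assms by (intro eq_matI) (auto simp: scalar_prod_def)

lemma adjoint_of_real_mat:
  "mat_adjoint (map_mat complex_of_real A) = map_mat complex_of_real (transpose_mat A)"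
  by (intro eq_matI) (auto simp: mat_adjoint_index mat_adjoint_def mat_of_rows_index)

lemma map_real_J: "map_mat complex_of_real (real_J n) = J_mat n"
  unfolding real_J_def J_mat_def by (intro eq_matI) auto

abbreviation twin_diag :: "nat \<Rightarrow> (nat \<Rightarrow> real) \<Rightarrow> complex mat" where
  "twin_diag n lam \<equiv> four_block_mat (mat_diag n (\<lambda>j. complex_of_real (lam j))) (0\<^sub>m n n)
     (0\<^sub>m n n) (mat_diag n (\<lambda>j. complex_of_real (lam j)))"

text \<open>Bundles the properties of both factors so that they can be picked by choice;
  \<open>S\<close> is a complex matrix with real entries because it will serve as a Fourier
  slice.\<close>

definition williamson_factors :: "nat \<Rightarrow> complex mat \<Rightarrow> complex mat \<Rightarrow> (nat \<Rightarrow> real) \<Rightarrow> bool" where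
  "williamson_factors n A S lam \<longleftrightarrow> S \<in> carrier_mat (2 * n) (2 * n) \<and> elements_mat S \<subseteq> \<real>
    \<and> (\<forall>j < n. lam j > 0) \<and> mat_adjoint S * J_mat n * S = J_mat n
    \<and> A = mat_adjoint S * twin_diag n lam * S"

text \<open>The real factorization maps entrywise into the complex matrices, where the adjoint of a
  real matrix is its transpose.\<close>

lemma williamson:
  assumes A: "A \<in> carrier_mat (2 * n) (2 * n)" and spd: "real_sym_pos_def A"
  shows "\<exists>S lam. williamson_factors n A S lam"
proof -
  obtain R where spdR: "sym_pos_def R" and AR: "A = map_mat complex_of_real R"
    using spd by (auto simp: real_sym_pos_def_def)
  have R: "R \<in> carrier_mat (2 * n) (2 * n)" using A by (simp add: AR)
  let ?D = "\<lambda>lam. four_block_mat (mat_diag n lam) (0\<^sub>m n n) (0\<^sub>m n n) (mat_diag n lam)"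
  obtain S lam where S: "S \<in> carrier_mat (2 * n) (2 * n)" and lam: "\<forall>j < n. lam j > 0"
    and SJ: "transpose_mat S * real_J n * S = real_J n" and SR: "R = transpose_mat S * ?D lam * S"
    using real_williamson[OF R spdR] by auto
  let ?c = "map_mat complex_of_real"
  have S': "transpose_mat S \<in> carrier_mat (2 * n) (2 * n)" using S by simp
  have D: "?D lam \<in> carrier_mat (2 * n) (2 * n)" by (auto simp: mat_diag_def)
  have Dc: "?c (?D lam) = twin_diag n lam"
    by (intro eq_matI) (auto simp: mat_diag_def)
  have cong: "?c (transpose_mat S * G * S) = mat_adjoint (?c S) * ?c G * ?c S"
    if "G \<in> carrier_mat (2 * n) (2 * n)" for G
    using that S S' by (simp add: real_of_mat_mult[of _ "2 * n" "2 * n" _ "2 * n"] adjoint_of_real_mat)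
  show ?thesis unfolding williamson_factors_def
  proof (intro exI conjI)
    show "?c S \<in> carrier_mat (2 * n) (2 * n)" using S by simp
    show "elements_mat (?c S) \<subseteq> \<real>" by (auto simp: elements_mat_def)
    show "mat_adjoint (?c S) * J_mat n * ?c S = J_mat n"
      using cong[OF real_J_carrier] by (simp add: SJ map_real_J)
    show "A = mat_adjoint (?c S) * twin_diag n lam * ?c S"
      using cong[OF D] by (simp add: AR Dc SR[symmetric])
  qed (rule lam)
qed

subsection \<open>Fourier slices of tensors\<close>

lemma root_unity_nonzero: "root_unity p \<noteq> 0"
  by (simp add: root_unity_def)

lemma cnj_root_unity: "cnj (root_unity p) = inverse (root_unity p)"
proof -
  have "root_unity p = cis (2 * pi / of_nat p)" by (simp add: root_unity_def cis_conv_exp mult_ac)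
  then show ?thesis by (simp add: cis_cnj)
qed

lemma root_unity_power_self: "p \<ge> 1 \<Longrightarrow> root_unity p ^ p = 1"
  by (simp add: root_unity_def exp_of_nat_mult[symmetric])

lemma root_unity_power_cong:
  assumes "p \<ge> 1" "a mod p = b mod p"
  shows "root_unity p ^ a = root_unity p ^ b"
proof -
  have "root_unity p ^ a = root_unity p ^ (a mod p)" for a
    using root_unity_power_self[OF assms(1)]
    by (metis mult_div_mod_eq power_add power_mult power_one mult_1)
  then show ?thesis using assms(2) by metis
qed

lemma fourier_slice_carrier:
  assumes "A \<in> carrier_tensor m n p" "p \<ge> 1"
  shows "fourier_slice A i \<in> carrier_mat m n"
  using assms by (simp add: fourier_slice_def carrier_tensorD)

text \<open>Counting from zero lets exponents and slice indices be computed modulo \<open>p\<close>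
  without the offsets \<open>i - 1\<close> and \<open>j - 1\<close>.\<close>

lemma fourier_slice_index:
  assumes "A \<in> carrier_tensor m n p" "p \<ge> 1" "r < m" "c < n"
  shows "fourier_slice A (Suc q) $$ (r, c)
    = (\<Sum>t < p. root_unity p ^ (q * t) * frontal_slice A (Suc t) $$ (r, c))"
proof -
  have "(\<Sum>j = 1..p. root_unity p ^ (q * (j - 1)) * frontal_slice A j $$ (r, c))
      = (\<Sum>t < p. root_unity p ^ (q * t) * frontal_slice A (Suc t) $$ (r, c))"
    by (rule sum.reindex_bij_witness[of _ Suc "\<lambda>j. j - 1"]) auto
  then show ?thesis using assms by (simp add: fourier_slice_def carrier_tensorD)
qed

section \<open>Convolution and conjugate transposition in the Fourier domain\<close>

text \<open>The T-product is a cyclic convolution of frontal slices: block column 0 of a block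
  circulant matrix lists the slices in order.\<close>

lemma tprod_index:
  assumes A: "A \<in> carrier_tensor m l p" and B: "B \<in> carrier_tensor l n p" and p: "p \<ge> 1"
    and r: "r < p" and ij: "i < m" "j < n"
  shows "frontal_slice (A *\<^sub>T B) (Suc r) $$ (i, j)
    = (\<Sum>t < p. \<Sum>k < l. frontal_slice A (Suc (nat ((int r - int t) mod int p))) $$ (i, k)
        * frontal_slice B (Suc t) $$ (k, j))"
proof -
  have 0: "0 < p" using p by simp
  have "frontal_slice (A *\<^sub>T B) (Suc r) $$ (i, j) = bcirc (A *\<^sub>T B) $$ (r * m + i, 0 * n + j)"
    using r by (subst bcirc_index[OF tprod_carrier[OF A B p] r 0 ij]) simp
  also have "\<dots> = (\<Sum>t < p. \<Sum>k < l. frontal_slice A (Suc (nat ((int r - int t) mod int p))) $$ (i, k)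
        * frontal_slice B (Suc t) $$ (k, j))"
    unfolding tprod_bcirc[OF A B p] bcirc_mult_index[OF A B r 0 ij]
    by (intro sum.cong refl) simp
  finally show ?thesis .
qed

text \<open>Shift theorem of the discrete Fourier transform. A cyclic shift only rotates the range
  of summation, and powers of the root depend on the exponent modulo \<open>p\<close>.\<close>

lemma fourier_shift:
  fixes g :: "nat \<Rightarrow> complex"
  assumes p: "p \<ge> 1" and t: "t < p"
  shows "(\<Sum>r < p. root_unity p ^ (q * r) * g (nat ((int r - int t) mod int p)))
    = root_unity p ^ (q * t) * (\<Sum>r < p. root_unity p ^ (q * r) * g r)"
proof -
  let ?w = "root_unity p" and ?s = "\<lambda>r. (int r - int t) mod int p"
  have pw: "?w ^ (q * r) = ?w ^ (q * t) * ?w ^ (q * nat (?s r))" for r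
  proof -
    have "int ((t + nat (?s r)) mod p) = int (r mod p)"
      using p by (simp add: zmod_int mod_simps)
    then have "(t + nat (?s r)) mod p = r mod p" by (simp only: of_nat_eq_iff)
    then have "(q * (t + nat (?s r))) mod p = (q * r) mod p" by (metis mod_mult_right_eq)
    then have "?w ^ (q * (t + nat (?s r))) = ?w ^ (q * r)" by (rule root_unity_power_cong[OF p])
    then show ?thesis by (simp add: distrib_left power_add)
  qed
  have "(\<Sum>r < p. ?w ^ (q * r) * g (nat (?s r)))
      = (\<Sum>r < p. ?w ^ (q * t) * (?w ^ (q * nat (?s r)) * g (nat (?s r))))"
    by (intro sum.cong refl) (subst pw, simp)
  \<comment> \<open>\<open>sum_mod_shift\<close> speaks of functions on the integers, hence the
    conversions by \<open>nat\<close> in its instance.\<close>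
  also have "\<dots> = (\<Sum>r < p. ?w ^ (q * t) * (?w ^ (q * r) * g r))"
    using sum_mod_shift[OF p, of "\<lambda>s. ?w ^ (q * t) * (?w ^ (q * nat s) * g (nat s))" t] by simp
  finally show ?thesis by (simp add: sum_distrib_left)
qed

text \<open>Convolution theorem: after reordering, the innermost sum over \<open>r\<close> is a
  shifted transform of \<open>A\<close>, and the shift factor it releases is the power needed for
  the transform of \<open>B\<close>.\<close>

lemma fourier_slice_tprod:
  assumes A: "A \<in> carrier_tensor m l p" and B: "B \<in> carrier_tensor l n p" and p: "p \<ge> 1"
    and i: "i \<in> {1..p}"
  shows "fourier_slice (A *\<^sub>T B) i = fourier_slice A i * fourier_slice B i"
proof (rule eq_matI)
  note AB = tprod_carrier[OF A B p]
  note cA = fourier_slice_carrier[OF A p, of i] and cB = fourier_slice_carrier[OF B p, of i]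
    and cAB = fourier_slice_carrier[OF AB p, of i]
  show "dim_row (fourier_slice (A *\<^sub>T B) i) = dim_row (fourier_slice A i * fourier_slice B i)"
    "dim_col (fourier_slice (A *\<^sub>T B) i) = dim_col (fourier_slice A i * fourier_slice B i)"
    using cA cB cAB by auto
  fix a c assume "a < dim_row (fourier_slice A i * fourier_slice B i)"
    "c < dim_col (fourier_slice A i * fourier_slice B i)"
  then have ac: "a < m" "c < n" using cA cB by auto
  obtain q where q: "i = Suc q" using i by (cases i) auto
  let ?w = "root_unity p"
  let ?a = "\<lambda>k s. frontal_slice A (Suc s) $$ (a, k)" and ?b = "\<lambda>k t. frontal_slice B (Suc t) $$ (k, c)"
  have "fourier_slice (A *\<^sub>T B) i $$ (a, c)
      = (\<Sum>r < p. \<Sum>t < p. \<Sum>k < l. ?w ^ (q * r) * ?a k (nat ((int r - int t) mod int p)) * ?b k t)"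
    unfolding q fourier_slice_index[OF AB p ac]
    by (intro sum.cong refl) (simp add: tprod_index[OF A B p _ ac] sum_distrib_left mult.assoc)
  also have "\<dots> = (\<Sum>t < p. \<Sum>r < p. \<Sum>k < l. ?w ^ (q * r) * ?a k (nat ((int r - int t) mod int p)) * ?b k t)"
    by (rule sum.swap)
  also have "\<dots> = (\<Sum>t < p. \<Sum>k < l. \<Sum>r < p. ?w ^ (q * r) * ?a k (nat ((int r - int t) mod int p)) * ?b k t)"
    by (intro sum.cong refl sum.swap)
  also have "\<dots> = (\<Sum>k < l. \<Sum>t < p. \<Sum>r < p. ?w ^ (q * r) * ?a k (nat ((int r - int t) mod int p)) * ?b k t)"
    by (rule sum.swap)
  also have "\<dots> = (\<Sum>k < l. \<Sum>t < p. (\<Sum>r < p. ?w ^ (q * r) * ?a k r) * (?w ^ (q * t) * ?b k t))"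
  proof (intro sum.cong refl)
    fix k t assume "t \<in> {..<p}"
    then have shift: "(\<Sum>r < p. ?w ^ (q * r) * ?a k (nat ((int r - int t) mod int p)))
        = ?w ^ (q * t) * (\<Sum>r < p. ?w ^ (q * r) * ?a k r)"
      using fourier_shift[OF p, of t q "?a k"] by simp
    show "(\<Sum>r < p. ?w ^ (q * r) * ?a k (nat ((int r - int t) mod int p)) * ?b k t)
        = (\<Sum>r < p. ?w ^ (q * r) * ?a k r) * (?w ^ (q * t) * ?b k t)"
      unfolding sum_distrib_right[symmetric] shift by (simp only: mult_ac)
  qed
  also have "\<dots> = (\<Sum>k < l. (\<Sum>r < p. ?w ^ (q * r) * ?a k r) * (\<Sum>t < p. ?w ^ (q * t) * ?b k t))"
    by (simp add: sum_distrib_left)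
  also have "\<dots> = (\<Sum>k < l. fourier_slice A i $$ (a, k) * fourier_slice B i $$ (k, c))"
    unfolding q using ac by (intro sum.cong refl) (simp add: fourier_slice_index[OF A p] fourier_slice_index[OF B p])
  also have "\<dots> = (fourier_slice A i * fourier_slice B i) $$ (a, c)"
    using cA cB ac by (auto simp: scalar_prod_def lessThan_atLeast0 intro!: sum.cong)
  finally show "fourier_slice (A *\<^sub>T B) i $$ (a, c) = (fourier_slice A i * fourier_slice B i) $$ (a, c)" .
qed

text \<open>Two reversals cancel: the slices of the conjugate transpose run backwards modulo
  \<open>p\<close>, and conjugation inverts the root of unity.\<close>

lemma fourier_slice_tconj_transpose:
  assumes A: "A \<in> carrier_tensor m n p" and p: "p \<ge> 1" and i: "i \<in> {1..p}"
  shows "fourier_slice (tconj_transpose A) i = mat_adjoint (fourier_slice A i)"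
proof (rule eq_matI)
  note AH = tconj_transpose_carrier[OF A]
  note cA = fourier_slice_carrier[OF A p, of i] and cAH = fourier_slice_carrier[OF AH p, of i]
  note cAA = mat_adjoint_carrier[OF cA]
  show "dim_row (fourier_slice (tconj_transpose A) i) = dim_row (mat_adjoint (fourier_slice A i))"
    "dim_col (fourier_slice (tconj_transpose A) i) = dim_col (mat_adjoint (fourier_slice A i))"
    using cAH cAA by auto
  fix a c assume "a < dim_row (mat_adjoint (fourier_slice A i))"
    "c < dim_col (mat_adjoint (fourier_slice A i))"
  then have ac: "a < n" "c < m" using cAA by auto
  obtain q where q: "i = Suc q" using i by (cases i) auto
  let ?w = "root_unity p" and ?v = "\<lambda>t. (p - t) mod p"
  have "fourier_slice (tconj_transpose A) i $$ (a, c)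
      = (\<Sum>t < p. ?w ^ (q * t) * frontal_slice (tconj_transpose A) (Suc t) $$ (a, c))"
    unfolding q by (rule fourier_slice_index[OF AH p ac])
  also have "\<dots> = (\<Sum>t < p. cnj (?w ^ (q * ?v t) * frontal_slice A (Suc (?v t)) $$ (c, a)))"
  proof (intro sum.cong refl)
    fix t assume "t \<in> {..<p}"
    then have t: "t < p" by simp
    have v: "?v t < p" using p by simp
    \<comment> \<open>Counted from zero, the slice index \<open>p - k + 2\<close> is
      \<open>p - t\<close>; reduction modulo \<open>p\<close> absorbs the separate case of the first
      slice.\<close>
    have idx: "(if Suc t = 1 then 1 else p - Suc t + 2) = Suc (?v t)" using t by auto
    have "frontal_slice (tconj_transpose A) (Suc t) = mat_adjoint (frontal_slice A (Suc (?v t)))"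
      unfolding tconj_transpose_def carrier_tensorD(3)[OF A p]
      using t by (subst frontal_slice_tensor_of_slices) (auto simp only: idx atLeastAtMost_iff)
    moreover have "frontal_slice A (Suc (?v t)) \<in> carrier_mat m n"
      using v by (intro frontal_slice_carrier[OF A]) auto
    ultimately have 1: "frontal_slice (tconj_transpose A) (Suc t) $$ (a, c)
        = cnj (frontal_slice A (Suc (?v t)) $$ (c, a))"
      using ac by (simp add: mat_adjoint_index)
    have "?w ^ (q * t) * ?w ^ (q * ?v t) = ?w ^ (q * (t + ?v t))"
      by (simp add: power_add distrib_left)
    also have "\<dots> = ?w ^ 0"
    proof (rule root_unity_power_cong[OF p])
      have "(t + ?v t) mod p = 0" using t by (simp add: mod_simps)
      then show "(q * (t + ?v t)) mod p = 0 mod p" by (metis mod_mult_right_eq mult_0_right)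
    qed
    finally have "?w ^ (q * t) = inverse (?w ^ (q * ?v t))"
      using root_unity_nonzero by (simp add: field_simps)
    then show "?w ^ (q * t) * frontal_slice (tconj_transpose A) (Suc t) $$ (a, c)
      = cnj (?w ^ (q * ?v t) * frontal_slice A (Suc (?v t)) $$ (c, a))"
      by (simp add: 1 cnj_root_unity power_inverse)
  qed
  also have "\<dots> = (\<Sum>t < p. cnj (?w ^ (q * t) * frontal_slice A (Suc t) $$ (c, a)))"
    by (rule sum.reindex_bij_witness[of _ ?v ?v]) (auto simp: mod_if)
  also have "\<dots> = cnj (fourier_slice A i $$ (c, a))"
    unfolding q fourier_slice_index[OF A p ac(2,1)] by simp
  also have "\<dots> = mat_adjoint (fourier_slice A i) $$ (a, c)"
    using ac cA by (simp add: mat_adjoint_index)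
  finally show "fourier_slice (tconj_transpose A) i $$ (a, c) = mat_adjoint (fourier_slice A i) $$ (a, c)" .
qed

section \<open>Fourier inversion and realness\<close>

lemma tensor_of_fourier_carrier: "tensor_of_fourier m n p F \<in> carrier_tensor m n p"
  unfolding tensor_of_fourier_def by (rule tensor_of_slices_carrier) auto

text \<open>Inversion in the order opposite to \<open>fourier_slice_tensor_of_fourier\<close>. The
  orthogonality \<open>root_unity_sum\<close> is now applied to the sum over the Fourier
  index.\<close>

lemma tensor_of_fourier_slices:
  assumes A: "A \<in> carrier_tensor m n p" and p: "p \<ge> 1"
  shows "tensor_of_fourier m n p (fourier_slice A) = A"
proof (rule tensor_eqI[OF tensor_of_fourier_carrier A])
  fix k assume k: "k \<in> {1..p}"
  let ?w = "root_unity p"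
  show "frontal_slice (tensor_of_fourier m n p (fourier_slice A)) k = frontal_slice A k"
    unfolding tensor_of_fourier_def frontal_slice_tensor_of_slices[OF k]
  proof (rule eq_matI)
    fix r c assume "r < dim_row (frontal_slice A k)" "c < dim_col (frontal_slice A k)"
    then have rc: "r < m" "c < n" using frontal_slice_carrier[OF A k] by auto
    have "(\<Sum>i = 1..p. inverse ?w ^ ((i - 1) * (k - 1)) * fourier_slice A i $$ (r, c))
        = (\<Sum>i = 1..p. \<Sum>j = 1..p. frontal_slice A j $$ (r, c) *
            (?w ^ ((j - 1) * (i - 1)) * inverse ?w ^ ((k - 1) * (i - 1))))"
      using rc by (simp add: fourier_slice_def carrier_tensorD[OF A p] sum_distrib_left mult_ac)
    also have "\<dots> = (\<Sum>j = 1..p. frontal_slice A j $$ (r, c) * (if j = k then of_nat p else 0))"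
      unfolding sum.swap[of _ "{1..p}" "{1..p}"] sum_distrib_left[symmetric]
      by (intro sum.cong refl) (simp only: root_unity_sum[OF p _ k])
    also have "\<dots> = (\<Sum>j = 1..p. if j = k then of_nat p * frontal_slice A j $$ (r, c) else 0)"
      by (intro sum.cong refl) simp
    also have "\<dots> = of_nat p * frontal_slice A k $$ (r, c)" using k by simp
    finally show "mat m n (\<lambda>rc. 1 / of_nat p * (\<Sum>i = 1..p. inverse ?w ^ ((i - 1) * (k - 1))
        * fourier_slice A i $$ rc)) $$ (r, c) = frontal_slice A k $$ (r, c)"
      using rc p by simp
  qed (use frontal_slice_carrier[OF A k] in auto)
qed

text \<open>The inverse transform recovers a tensor from its Fourier slices, so equations between
  tensors reduce to equations between matrices.\<close>

lemma tensor_eq_fourierI: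
  assumes "A \<in> carrier_tensor m n p" "B \<in> carrier_tensor m n p" "p \<ge> 1"
    and eq: "\<And>i. i \<in> {1..p} \<Longrightarrow> fourier_slice A i = fourier_slice B i"
  shows "A = B"
proof -
  have "tensor_of_fourier m n p (fourier_slice A) = tensor_of_fourier m n p (fourier_slice B)"
    unfolding tensor_of_fourier_def tensor_of_slices_def using eq
    by (intro map_cong refl arg_cong[of _ _ "mat m n"] ext arg_cong2[of _ _ _ _ "(*)"] sum.cong) auto
  then show ?thesis using assms by (simp add: tensor_of_fourier_slices)
qed

text \<open>Conjugating the inverse transform of real slices turns the inverse root into the root;
  reversing the slices, which leaves \<open>F\<close> unchanged, turns it back. Hence every entry
  equals its conjugate.\<close>

lemma real_tensor_of_fourier:
  assumes p: "p \<ge> 1" and F: "\<And>i. i \<in> {1..p} \<Longrightarrow> F i \<in> carrier_mat m n"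
    and real: "\<And>i. i \<in> {1..p} \<Longrightarrow> elements_mat (F i) \<subseteq> \<real>"
    and sym: "\<And>i. i \<in> {2..p} \<Longrightarrow> F (p - i + 2) = F i"
  shows "real_tensor (tensor_of_fourier m n p F)"
proof -
  \<comment> \<open>\<open>?v\<close> is negation modulo \<open>p\<close> on indices counted from 1,
    an involution that fixes 1.\<close>
  let ?w = "root_unity p" and ?v = "\<lambda>i. if i = 1 then 1 else p - i + 2"
  have vv: "?v (?v i) = i" "?v i \<in> {1..p}" if "i \<in> {1..p}" for i using that by auto
  have "(\<Sum>i = 1..p. inverse ?w ^ ((i - 1) * j) * F i $$ (r, c)) \<in> \<real>"
    if rc: "r < m" "c < n" for j r c
  proof -
    have "cnj (\<Sum>i = 1..p. inverse ?w ^ ((i - 1) * j) * F i $$ (r, c))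
        = (\<Sum>i = 1..p. ?w ^ ((i - 1) * j) * F i $$ (r, c))"
      unfolding cnj_sum
    proof (intro sum.cong refl)
      fix i assume i: "i \<in> {1..p}"
      have "F i $$ (r, c) \<in> elements_mat (F i)" using F[OF i] rc by (intro elements_matI) auto
      then have "cnj (F i $$ (r, c)) = F i $$ (r, c)" using real[OF i] by (auto simp: Reals_cnj_iff)
      then show "cnj (inverse ?w ^ ((i - 1) * j) * F i $$ (r, c)) = ?w ^ ((i - 1) * j) * F i $$ (r, c)"
        by (simp add: cnj_root_unity)
    qed
    also have "\<dots> = (\<Sum>i = 1..p. ?w ^ ((?v i - 1) * j) * F (?v i) $$ (r, c))"
      by (rule sum.reindex_bij_witness[of _ ?v ?v]) (simp_all only: vv)
    also have "\<dots> = (\<Sum>i = 1..p. inverse ?w ^ ((i - 1) * j) * F i $$ (r, c))"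
    proof (intro sum.cong refl)
      fix i assume i: "i \<in> {1..p}"
      have "?w ^ ((?v i - 1) * j) = inverse ?w ^ ((i - 1) * j)"
      proof (cases "i = 1")
        case False
        \<comment> \<open>The exponents add up to a multiple of \<open>p\<close>, so the two powers
          are inverse to each other.\<close>
        then have "(?v i - 1) * j + (i - 1) * j = p * j"
          unfolding distrib_right[symmetric] using i by (intro arg_cong2[of _ _ _ _ "(*)"]) auto
        then have "?w ^ ((?v i - 1) * j) * ?w ^ ((i - 1) * j) = 1"
          unfolding power_add[symmetric] by (simp add: power_mult root_unity_power_self[OF p])
        then show ?thesis using root_unity_nonzero by (simp add: power_inverse field_simps)
      qed simp
      then show "?w ^ ((?v i - 1) * j) * F (?v i) $$ (r, c) = inverse ?w ^ ((i - 1) * j) * F i $$ (r, c)"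
        using sym[of i] i by (cases "i = 1") auto
    qed
    finally show ?thesis by (simp add: Reals_cnj_iff)
  qed
  then show ?thesis
    unfolding real_tensor_def tensor_of_fourier_def tensor_of_slices_def
    by (auto simp: elements_mat_def simp del: upt_Suc intro!: Reals_mult)
qed

section \<open>Assembly of the factor tensors\<close>

theorem corollary3p18:
  fixes n p :: nat and M :: "complex tensor"
  assumes "n \<ge> 1" and "p \<ge> 1"
    and "M \<in> carrier_tensor (2 * n) (2 * n) p"
    and "\<And>i. i \<in> {1..p} \<Longrightarrow> real_sym_pos_def (fourier_slice M i)"
    and "fourier_slice M 1 = map_mat cnj (fourier_slice M 1)"
    and "\<And>i. i \<in> {2..p} \<Longrightarrow> fourier_slice M (p - i + 2) = map_mat cnj (fourier_slice M i)"
  shows "\<exists>S D. S \<in> carrier_tensor (2 * n) (2 * n) p \<and> D \<in> carrier_tensor (2 * n) (2 * n) p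
    \<and> real_tensor S \<and> real_tensor D
    \<and> t_symplectic n p S \<and> t_diagonal D
    \<and> M = tconj_transpose S *\<^sub>T D *\<^sub>T S
    \<and> (\<forall>i \<in> {1..p}. \<exists>\<Lambda> lam.
          fourier_slice D i = four_block_mat \<Lambda> (0\<^sub>m n n) (0\<^sub>m n n) \<Lambda>
        \<and> \<Lambda> = mat_diag n (\<lambda>j. complex_of_real (lam j))
        \<and> (\<forall>j < n. lam j > 0))"
proof -
  note p = assms(2) and M = assms(3)
  \<comment> \<open>A real slice is fixed by \<open>cnj\<close>, so conjugate symmetry becomes
    equality of the slices at \<open>i\<close> and \<open>p - i + 2\<close>.\<close>
  have sym: "fourier_slice M (p - i + 2) = fourier_slice M i" if i: "i \<in> {2..p}" for i
  proof -
    obtain R where "fourier_slice M i = map_mat complex_of_real R"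
      using assms(4)[of i] i by (auto simp: real_sym_pos_def_def)
    then have "map_mat cnj (fourier_slice M i) = fourier_slice M i" by (intro eq_matI) auto
    then show ?thesis using assms(6)[OF i] by simp
  qed
  text \<open>Choosing the factors as functions of the slice, not of its index, makes them inherit
    the conjugate symmetry of the slices.\<close>
  define s where "s A = (SOME S. \<exists>lam. williamson_factors n A S lam)" for A
  define l where "l A = (SOME lam. williamson_factors n A (s A) lam)" for A
  have "williamson_factors n A (s A) (l A)"
    if "A \<in> carrier_mat (2 * n) (2 * n)" "real_sym_pos_def A" for A
  proof -
    have "\<exists>lam. williamson_factors n A (s A) lam"
      unfolding s_def using williamson[OF that] by (rule someI_ex)
    then show ?thesis unfolding l_def by (rule someI_ex)
  qed
  note factors = this[OF fourier_slice_carrier[OF M p] assms(4), unfolded williamson_factors_def]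
  have W: "s (fourier_slice M i) \<in> carrier_mat (2 * n) (2 * n)"
    "elements_mat (s (fourier_slice M i)) \<subseteq> \<real>" "\<forall>j < n. l (fourier_slice M i) j > 0"
    "mat_adjoint (s (fourier_slice M i)) * J_mat n * s (fourier_slice M i) = J_mat n"
    "fourier_slice M i = mat_adjoint (s (fourier_slice M i)) * twin_diag n (l (fourier_slice M i))
      * s (fourier_slice M i)" if "i \<in> {1..p}" for i
    using factors[OF that] by blast+
  define S where "S = tensor_of_fourier (2 * n) (2 * n) p (\<lambda>i. s (fourier_slice M i))"
  define D where "D = tensor_of_fourier (2 * n) (2 * n) p (\<lambda>i. twin_diag n (l (fourier_slice M i)))"
  have S: "S \<in> carrier_tensor (2 * n) (2 * n) p" and D: "D \<in> carrier_tensor (2 * n) (2 * n) p"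
    and J: "J_tensor n p \<in> carrier_tensor (2 * n) (2 * n) p"
    unfolding S_def D_def J_tensor_def by (rule tensor_of_fourier_carrier)+
  note SH = tconj_transpose_carrier[OF S]
  have twin: "twin_diag n lam \<in> carrier_mat (2 * n) (2 * n)" "elements_mat (twin_diag n lam) \<subseteq> \<real>"
    "diagonal_mat (twin_diag n lam)" for lam
    by (auto simp: mat_diag_def elements_mat_def diagonal_mat_def split: if_splits)
  have fS: "fourier_slice S i = s (fourier_slice M i)"
    and fD: "fourier_slice D i = twin_diag n (l (fourier_slice M i))" if "i \<in> {1..p}" for i
    unfolding S_def D_def using that W(1) twin(1)
    by (intro fourier_slice_tensor_of_fourier[OF p]; blast)+
  \<comment> \<open>The tensor congruence by \<open>S\<close> is a slicewise matrix congruence in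
    the Fourier domain; it serves both for \<open>J_tensor n p\<close> and for
    \<open>D\<close>.\<close>
  have conj_slice: "fourier_slice (tconj_transpose S *\<^sub>T G *\<^sub>T S) i
      = mat_adjoint (s (fourier_slice M i)) * fourier_slice G i * s (fourier_slice M i)"
    if "G \<in> carrier_tensor (2 * n) (2 * n) p" "i \<in> {1..p}" for G i
    using that by (simp add: fourier_slice_tprod[OF tprod_carrier[OF SH that(1) p] S p]
      fourier_slice_tprod[OF SH that(1) p] fourier_slice_tconj_transpose[OF S p] fS)
  have conj_carrier: "tconj_transpose S *\<^sub>T G *\<^sub>T S \<in> carrier_tensor (2 * n) (2 * n) p"
    if "G \<in> carrier_tensor (2 * n) (2 * n) p" for G
    by (rule tprod_carrier[OF tprod_carrier[OF SH that p] S p])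
  have "tconj_transpose S *\<^sub>T J_tensor n p *\<^sub>T S = J_tensor n p"
    using p by (intro tensor_eq_fourierI[OF conj_carrier[OF J] J])
      (simp_all add: conj_slice[OF J] fourier_slice_J_tensor W(4))
  then have "t_symplectic n p S" using S by (simp add: t_symplectic_def)
  moreover have "M = tconj_transpose S *\<^sub>T D *\<^sub>T S"
    using p W(5) by (intro tensor_eq_fourierI[OF M conj_carrier[OF D]])
      (simp_all only: conj_slice[OF D] fD)
  \<comment> \<open>By \<open>sym\<close>, the slices at \<open>i\<close> and
    \<open>p - i + 2\<close> have the same value under \<open>s\<close>, which is the symmetry that
    \<open>real_tensor_of_fourier\<close> asks for; likewise for \<open>l\<close> and
    \<open>D\<close>.\<close>
  moreover have "real_tensor S" unfolding S_def
    by (rule real_tensor_of_fourier[OF p]) (use W(1,2) sym in \<open>simp_all only:\<close>)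
  moreover have "real_tensor D" unfolding D_def
    by (rule real_tensor_of_fourier[OF p]) (use twin sym in \<open>simp_all only:\<close>)
  moreover have "t_diagonal D"
    using D twin(3) fD by (auto simp: t_diagonal_def carrier_tensor_def)
  ultimately show ?thesis using S D fD W(3) by blast
qed

end
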